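(* Let $\Omega$ be an $n$-dimensional manifold with sufficiently smooth Lipschitz boundary and let $H\Lambda_h^{(\bullet)}(\Omega)\subset H\Lambda^{(\bullet)}(\Omega)$ be a finite-dimensional subcomplex. Then the operator $\Pi^{(k)}:H\Lambda^{(k)}(\Omega)\to H\Lambda_h^{(k)}(\Omega)$ defined by the augmented mixed system (given in the context) is a projection onto $H\Lambda_h^{(k)}(\Omega)$. In particular, $\Pi^{(k)}\Pi^{(k)}\phi=\Pi^{(k)}\phi$ for all $\phi\in H\Lambda^{(k)}(\Omega)$, and $\Pi^{(k)}\lambda=\lambda$ for all $\lambda\in H\Lambda_h^{(k)}(\Omega)$.
   Context: $H\Lambda^{(k)}(\Omega)$ is the Hilbert space of $L^2$ differential $k$-forms on $\Omega$ whose exterior derivative is in $L^2$, with $L^2$ inner product $(\alpha,\beta)=\int_\Omega\alpha\wedge\star\beta$. The sequence $\mathbb R\hookrightarrow H\Lambda^{(0)}(\Omega)\xrightarrow{\mathrm d}\cdots\xrightarrow{\mathrm d}H\Lambda^{(n)}(\Omega)\to0$ is a closed Hilbert complex; spaces of degree $>n$ are zero. A finite-dimensional subcomplex consists of finite-dimensional subspaces $H\Lambda_h^{(k)}(\Omega)\subset H\Lambda^{(k)}(\Omega)$ with $\mathrm dH\Lambda_h^{(k)}(\Omega)\subset H\Lambda_h^{(k+1)}(\Omega)$ (including $\mathbb R\hookrightarrow H\Lambda_h^{(0)}(\Omega)$). $\mathcal Z_h^{(k)}=\{\omega\in H\Lambda_h^{(k)}(\Omega):\mathrm d\omega=0\}$,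 $\mathcal R_h^{(k)}=\mathrm dH\Lambda_h^{(k-1)}(\Omega)$, and the discrete harmonic space $\mathcal H_h^{(k)}$ is the $L^2$-orthogonal complement of $\mathcal R_h^{(k)}$ in $\mathcal Z_h^{(k)}$. Definition of $\Pi^{(k)}$: given $\phi^{(k)}\in H\Lambda^{(k)}(\Omega)$, find $\lambda^{(i)}\in H\Lambda_h^{(i)}(\Omega)$, $i=k,k+1,k+2$, and $h^{(k+1)}\in\mathcal H_h^{(k+1)}$ such that for all $\eta^{(j)}\in H\Lambda_h^{(j)}(\Omega)$, $j=k,k+1,k+2$, and all $\gamma^{(k+1)}\in\mathcal H_h^{(k+1)}$, $$\begin{aligned}(\eta^{(k)},\lambda^{(k)})+(\mathrm d\eta^{(k)},\lambda^{(k+1)})&=(\eta^{(k)},\phi^{(k)}),\\(\eta^{(k+1)},\mathrm d\lambda^{(k)})+(\mathrm d\eta^{(k+1)},\lambda^{(k+2)})+(\eta^{(k+1)},h^{(k+1)})&=(\eta^{(k+1)},\mathrm d\phi^{(k)}),\\(\eta^{(k+2)},\mathrm d\lambda^{(k+1)})&=0,\\(\gamma^{(k+1)},\lambda^{(k+1)})&=0.\end{aligned}$$ A solution exists and its component $\lambda^{(k)}$ is unique; set $\Pi^{(k)}\phi^{(k)}=\lambda^{(k)}$. *)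

theory Defs
  imports "HOL-Analysis.Analysis"
begin

section \<open>Smooth maps\<close>

primrec Ck_on :: "nat \<Rightarrow> ('a::real_normed_vector \<Rightarrow> 'b::real_normed_vector) \<Rightarrow> 'a set \<Rightarrow> bool" where
  "Ck_on 0 f S \<longleftrightarrow> continuous_on S f"
| "Ck_on (Suc k) f S \<longleftrightarrow>
     (\<exists>f'. (\<forall>x\<in>S. (f has_derivative f' x) (at x)) \<and> (\<forall>v. Ck_on k (\<lambda>x. f' x v) S))"

text \<open>Meaningful for open \<open>S\<close> only.\<close>

definition smooth_on :: "'a set \<Rightarrow> ('a::real_normed_vector \<Rightarrow> 'b::real_normed_vector) \<Rightarrow> bool" where
  "smooth_on S f \<longleftrightarrow> (\<forall>k. Ck_on k f S)"

text \<open>Smoothness on an arbitrary set (here: up to the boundary), by local smooth extension.\<close>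

definition smooth_up_to :: "'a set \<Rightarrow> ('a::real_normed_vector \<Rightarrow> 'b::real_normed_vector) \<Rightarrow> bool" where
  "smooth_up_to S f \<longleftrightarrow>
     (\<forall>x\<in>S. \<exists>V F. open V \<and> x \<in> V \<and> smooth_on V F \<and> (\<forall>y\<in>V \<inter> S. F y = f y))"

definition test_function :: "'a set \<Rightarrow> ('a::real_normed_vector \<Rightarrow> real) \<Rightarrow> bool" where
  "test_function W \<psi> \<longleftrightarrow> smooth_on UNIV \<psi> \<and>
     compact (closure {x. \<psi> x \<noteq> 0}) \<and> closure {x. \<psi> x \<noteq> 0} \<subseteq> W"

section \<open>Riemannian manifolds with Lipschitz boundary\<close>

definition lipschitz_epigraph :: "'a::euclidean_space set \<Rightarrow> bool" where
  "lipschitz_epigraph S \<longleftrightarrow>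
     (\<exists>u f L. norm u = 1 \<and> L-lipschitz_on UNIV f \<and> S = {x. f (x - (x \<bullet> u) *\<^sub>R u) \<le> x \<bullet> u})"

text \<open>
  A manifold is given by its topological space, a countable atlas (chart domains \<open>dom_of\<close>, which
  may be empty or repeated, and chart maps) and the matrices \<open>g_ij\<close> of its Riemannian metric in
  each chart.  By second countability a countable atlas is no restriction.
  The dimension is \<open>CARD('n)\<close>; the order on \<open>'n\<close> is the order of the coordinates.
\<close>

record ('m, 'n) manifold_data =
  top_of :: "'m topology"
  dom_of :: "nat \<Rightarrow> 'm set"
  chart_of :: "nat \<Rightarrow> 'm \<Rightarrow> real^'n::finite"
  metric_of :: "nat \<Rightarrow> real^'n \<Rightarrow> real^'n^'n"

definition img_of :: "('m, 'n::finite) manifold_data \<Rightarrow> nat \<Rightarrow> (real^'n) set" where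
  "img_of M i = chart_of M i ` dom_of M i"

definition overlap :: "('m, 'n::finite) manifold_data \<Rightarrow> nat \<Rightarrow> nat \<Rightarrow> (real^'n) set" where
  "overlap M i j = chart_of M i ` (dom_of M i \<inter> dom_of M j)"

definition transition :: "('m, 'n::finite) manifold_data \<Rightarrow> nat \<Rightarrow> nat \<Rightarrow> real^'n \<Rightarrow> real^'n" where
  "transition M i j x = chart_of M j (inv_into (dom_of M i) (chart_of M i) x)"

definition lipschitz_riemannian_manifold :: "('m, 'n::finite) manifold_data \<Rightarrow> bool" where
  "lipschitz_riemannian_manifold M \<longleftrightarrow>
     Hausdorff_space (top_of M) \<and> second_countable (top_of M) \<and>
     (\<Union>i. dom_of M i) = topspace (top_of M) \<and>
     (\<forall>i. openin (top_of M) (dom_of M i) \<and>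
          homeomorphic_map (subtopology (top_of M) (dom_of M i)) (top_of_set (img_of M i))
            (chart_of M i) \<and>
          (\<exists>S. lipschitz_epigraph S \<and> openin (top_of_set S) (img_of M i))) \<and>
     (\<forall>i j. smooth_up_to (overlap M i j) (transition M i j)) \<and>
     (\<forall>i. smooth_up_to (img_of M i) (metric_of M i)) \<and>
     (\<forall>i. \<forall>x\<in>img_of M i. transpose (metric_of M i x) = metric_of M i x \<and>
          (\<forall>v. v \<noteq> 0 \<longrightarrow> v \<bullet> (metric_of M i x *v v) > 0)) \<and>
     (\<forall>i j. \<forall>x\<in>interior (overlap M i j).
          metric_of M i x =
            transpose (jacobian (transition M i j) (at x)) **
            metric_of M j (transition M i j x) ** jacobian (transition M i j) (at x))"

section \<open>Exterior algebra in coordinates\<close>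

type_synonym 'n point = "real^'n"
type_synonym 'n matrix = "real^'n^'n"

text \<open>
  A covector \<open>\<Sum>\<^sub>I a\<^sub>I dx\<^sup>I\<close> is represented by its coefficients; \<open>I\<close> is the set of the indices
  \<open>i\<^sub>1 < \<dots> < i\<^sub>k\<close> and \<open>dx\<^sup>I = dx\<^sup>i\<^sup>1 \<and> \<dots> \<and> dx\<^sup>i\<^sup>k\<close>.
\<close>

type_synonym 'n covector = "'n set \<Rightarrow> real"

text \<open>\<open>dx\<^sup>I \<and> dx\<^sup>J = shuffle_sign I J \<cdot> dx\<^sup>(\<^sup>I\<^sup>\<union>\<^sup>J\<^sup>)\<close> for disjoint \<open>I\<close>, \<open>J\<close>.\<close>

definition shuffle_sign :: "'n::linorder set \<Rightarrow> 'n set \<Rightarrow> real" where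
  "shuffle_sign I J = (- 1) ^ card {(i, j). i \<in> I \<and> j \<in> J \<and> j < i}"

definition wedge :: "'n::{finite,linorder} covector \<Rightarrow> 'n covector \<Rightarrow> 'n covector" where
  "wedge a b K = (\<Sum>I\<in>Pow K. shuffle_sign I (K - I) * a I * b (K - I))"

text \<open>The minor of \<open>A\<close> with rows \<open>I\<close> and columns \<open>J\<close>; used for \<open>card I = card J\<close> only.\<close>

definition minor :: "'n::{finite,linorder} matrix \<Rightarrow> 'n set \<Rightarrow> 'n set \<Rightarrow> real" where
  "minor A I J =
     (\<Sum>p | p permutes {..<card I}. of_int (sign p) *
        (\<Prod>r<card I. A $ (sorted_list_of_set I ! r) $ (sorted_list_of_set J ! p r)))"

definition pullback_covector :: "'n::{finite,linorder} matrix \<Rightarrow> 'n covector \<Rightarrow> 'n covector" where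
  "pullback_covector A b I = (\<Sum>J | card J = card I. minor A J I * b J)"

text \<open>
  The coefficients \<open>b\<^sup>I\<close> with raised indices for the metric matrix \<open>g\<close>; the pointwise inner product
  is \<open>\<langle>a, b\<rangle>\<^sub>g = \<Sum>\<^sub>I a\<^sub>I b\<^sup>I\<close>.
\<close>

definition raise_indices :: "'n::{finite,linorder} matrix \<Rightarrow> 'n covector \<Rightarrow> 'n covector" where
  "raise_indices g b I = (\<Sum>J | card J = card I. minor (matrix_inv g) I J * b J)"

text \<open>
  The Hodge star for \<open>g\<close> and the orientation of the coordinates, i.e.
  \<open>a \<and> \<star>b = \<langle>a, b\<rangle>\<^sub>g \<surd>(det g) dx\<^sup>1 \<and> \<dots> \<and> dx\<^sup>n\<close>.
\<close>

definition hodge_star :: "'n::{finite,linorder} matrix \<Rightarrow> 'n covector \<Rightarrow> 'n covector" where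
  "hodge_star g b K = sqrt (det g) * shuffle_sign (- K) K * raise_indices g b (- K)"

section \<open>Differential forms and the spaces \<open>H\<Lambda>\<close>\<close>

text \<open>
  A form is the family of its coordinate expressions \<open>\<omega> i x I\<close> (chart, point of the chart image,
  multi-index).  Elements of \<open>L\<^sup>2\<close> are represented by functions; their equality is \<open>form_eq\<close>.
\<close>

type_synonym 'n form = "nat \<Rightarrow> 'n point \<Rightarrow> 'n covector"

definition form_eq :: "('m, 'n::finite) manifold_data \<Rightarrow> 'n form \<Rightarrow> 'n form \<Rightarrow> bool" where
  "form_eq M \<alpha> \<beta> \<longleftrightarrow> (\<forall>i. AE x in lebesgue. x \<in> img_of M i \<longrightarrow> \<alpha> i x = \<beta> i x)"

definition zero_form :: "'n::finite form" where
  "zero_form i x I = 0"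

definition lin_form :: "real \<Rightarrow> 'n::finite form \<Rightarrow> real \<Rightarrow> 'n form \<Rightarrow> 'n form" where
  "lin_form a \<alpha> b \<beta> i x I = a * \<alpha> i x I + b * \<beta> i x I"

definition const_form :: "real \<Rightarrow> 'n::finite form" where
  "const_form c i x I = (if I = {} then c else 0)"

text \<open>
  The integral of an \<open>n\<close>-form is computed on the disjoint measurable pieces
  \<open>dom_of M i - (\<Union>j<i. dom_of M j)\<close>, each lying in one chart.
\<close>

definition piece :: "('m, 'n::finite) manifold_data \<Rightarrow> nat \<Rightarrow> 'n point set" where
  "piece M i = chart_of M i ` (dom_of M i - (\<Union>j<i. dom_of M j))"

text \<open>
  The \<open>n\<close>-form \<open>\<alpha> \<and> \<star>\<beta>\<close>, as its coefficient of \<open>dx\<^sup>1 \<and> \<dots> \<and> dx\<^sup>n\<close>.  As the star is taken with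
  respect to the orientation of each chart, this is a density and no orientation of the manifold
  is needed; on an oriented atlas it is the usual \<open>n\<close>-form.
\<close>

definition pairing ::
    "('m, 'n::{finite,linorder}) manifold_data \<Rightarrow> 'n form \<Rightarrow> 'n form \<Rightarrow> nat \<Rightarrow> 'n point \<Rightarrow> real" where
  "pairing M \<alpha> \<beta> i x = wedge (\<alpha> i x) (hodge_star (metric_of M i x) (\<beta> i x)) UNIV"

definition l2_inner ::
    "('m, 'n::{finite,linorder}) manifold_data \<Rightarrow> 'n form \<Rightarrow> 'n form \<Rightarrow> real" where
  "l2_inner M \<alpha> \<beta> = (\<Sum>i. LINT x:piece M i|lebesgue. pairing M \<alpha> \<beta> i x)"

definition L2_forms :: "('m, 'n::{finite,linorder}) manifold_data \<Rightarrow> nat \<Rightarrow> 'n form set" where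
  "L2_forms M k = {\<omega>.
     (\<forall>i x I. card I \<noteq> k \<longrightarrow> \<omega> i x I = 0) \<and>
     (\<forall>i I. set_borel_measurable lebesgue (img_of M i) (\<lambda>x. \<omega> i x I)) \<and>
     (\<forall>i j. AE x in lebesgue. x \<in> interior (overlap M i j) \<longrightarrow>
        \<omega> i x = pullback_covector (jacobian (transition M i j) (at x))
                  (\<omega> j (transition M i j x))) \<and>
     (\<forall>i. set_integrable lebesgue (piece M i) (pairing M \<omega> \<omega> i)) \<and>
     summable (\<lambda>i. LINT x:piece M i|lebesgue. pairing M \<omega> \<omega> i x)}"

text \<open>
  Weak form of \<open>(d a)\<^sub>K = \<Sum>\<^sub>j\<^sub>\<in>\<^sub>K shuffle_sign {j} (K - {j}) \<partial>\<^sub>j a\<^bsub>K-{j}\<^esub>\<close> on an open set \<open>W\<close>.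
\<close>

definition weak_ext_deriv_on ::
    "'n::{finite,linorder} point set \<Rightarrow> ('n point \<Rightarrow> 'n covector) \<Rightarrow> ('n point \<Rightarrow> 'n covector) \<Rightarrow> bool"
  where
  "weak_ext_deriv_on W a b \<longleftrightarrow>
     (\<forall>C I. compact C \<and> C \<subseteq> W \<longrightarrow>
        set_integrable lebesgue C (\<lambda>x. a x I) \<and> set_integrable lebesgue C (\<lambda>x. b x I)) \<and>
     (\<forall>\<psi> K. test_function W \<psi> \<longrightarrow>
        (LINT x:W|lebesgue. \<Sum>j\<in>K. shuffle_sign {j} (K - {j}) * a x (K - {j}) *
            frechet_derivative \<psi> (at x) (axis j 1))
        = - (LINT x:W|lebesgue. b x K * \<psi> x))"

text \<open>
  The distributional exterior derivative is local and natural, so it is tested in every chart, on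
  the interior of the chart image (no condition at the boundary of the manifold).
\<close>

definition is_ext_deriv ::
    "('m, 'n::{finite,linorder}) manifold_data \<Rightarrow> 'n form \<Rightarrow> 'n form \<Rightarrow> bool" where
  "is_ext_deriv M \<omega> \<eta> \<longleftrightarrow> (\<forall>i. weak_ext_deriv_on (interior (img_of M i)) (\<omega> i) (\<eta> i))"

definition HL :: "('m, 'n::{finite,linorder}) manifold_data \<Rightarrow> nat \<Rightarrow> 'n form set" where
  "HL M k = {\<omega> \<in> L2_forms M k. \<exists>\<eta>\<in>L2_forms M (Suc k). is_ext_deriv M \<omega> \<eta>}"

text \<open>A representative of \<open>d\<omega>\<close>, which is determined up to \<open>form_eq\<close>.\<close>

definition ext_d :: "('m, 'n::{finite,linorder}) manifold_data \<Rightarrow> nat \<Rightarrow> 'n form \<Rightarrow> 'n form" where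
  "ext_d M k \<omega> = (SOME \<eta>. \<eta> \<in> L2_forms M (Suc k) \<and> is_ext_deriv M \<omega> \<eta>)"

section \<open>Finite-dimensional subcomplexes\<close>

text \<open>
  A subspace of \<open>H\<Lambda>\<close> is given by the set of all functions representing its elements, hence is
  closed under \<open>form_eq\<close>.
\<close>

definition findim_subspace ::
    "('m, 'n::{finite,linorder}) manifold_data \<Rightarrow> nat \<Rightarrow> 'n form set \<Rightarrow> bool" where
  "findim_subspace M k V \<longleftrightarrow>
     V \<subseteq> HL M k \<and> zero_form \<in> V \<and>
     (\<forall>\<alpha>\<in>V. \<forall>\<beta>\<in>V. \<forall>a b. lin_form a \<alpha> b \<beta> \<in> V) \<and>
     (\<forall>\<alpha>\<in>V. \<forall>\<beta>\<in>HL M k. form_eq M \<alpha> \<beta> \<longrightarrow> \<beta> \<in> V) \<and>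
     (\<exists>B. finite B \<and> B \<subseteq> V \<and>
        (\<forall>\<omega>\<in>V. \<exists>c. form_eq M \<omega> (\<lambda>i x I. \<Sum>\<beta>\<in>B. c \<beta> * \<beta> i x I)))"

definition findim_subcomplex ::
    "('m, 'n::{finite,linorder}) manifold_data \<Rightarrow> (nat \<Rightarrow> 'n form set) \<Rightarrow> bool" where
  "findim_subcomplex M V \<longleftrightarrow>
     (\<forall>k. findim_subspace M k (V k)) \<and>
     (\<forall>k. \<forall>\<omega>\<in>V k. ext_d M k \<omega> \<in> V (Suc k)) \<and>
     (\<forall>c. const_form c \<in> V 0)"

definition discrete_cycles ::
    "('m, 'n::{finite,linorder}) manifold_data \<Rightarrow> (nat \<Rightarrow> 'n form set) \<Rightarrow> nat \<Rightarrow> 'n form set" where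
  "discrete_cycles M V k = {\<omega> \<in> V k. form_eq M (ext_d M k \<omega>) zero_form}"

definition discrete_range ::
    "('m, 'n::{finite,linorder}) manifold_data \<Rightarrow> (nat \<Rightarrow> 'n form set) \<Rightarrow> nat \<Rightarrow> 'n form set" where
  "discrete_range M V k = (case k of 0 \<Rightarrow> {zero_form} | Suc m \<Rightarrow> ext_d M m ` V m)"

definition discrete_harmonic ::
    "('m, 'n::{finite,linorder}) manifold_data \<Rightarrow> (nat \<Rightarrow> 'n form set) \<Rightarrow> nat \<Rightarrow> 'n form set" where
  "discrete_harmonic M V k =
     {\<omega> \<in> discrete_cycles M V k. \<forall>\<rho>\<in>discrete_range M V k. l2_inner M \<rho> \<omega> = 0}"

section \<open>The operator \<open>\<Pi>\<close>\<close>

definition mixed_solution ::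
    "('m, 'n::{finite,linorder}) manifold_data \<Rightarrow> (nat \<Rightarrow> 'n form set) \<Rightarrow> nat \<Rightarrow> 'n form \<Rightarrow>
     'n form \<Rightarrow> 'n form \<Rightarrow> 'n form \<Rightarrow> 'n form \<Rightarrow> bool" where
  "mixed_solution M V k \<phi> l0 l1 l2 h \<longleftrightarrow>
     l0 \<in> V k \<and> l1 \<in> V (k + 1) \<and> l2 \<in> V (k + 2) \<and> h \<in> discrete_harmonic M V (k + 1) \<and>
     (\<forall>\<eta>\<in>V k. l2_inner M \<eta> l0 + l2_inner M (ext_d M k \<eta>) l1 = l2_inner M \<eta> \<phi>) \<and>
     (\<forall>\<eta>\<in>V (k + 1). l2_inner M \<eta> (ext_d M k l0) + l2_inner M (ext_d M (k + 1) \<eta>) l2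
                    + l2_inner M \<eta> h = l2_inner M \<eta> (ext_d M k \<phi>)) \<and>
     (\<forall>\<eta>\<in>V (k + 2). l2_inner M \<eta> (ext_d M (k + 1) l1) = 0) \<and>
     (\<forall>\<gamma>\<in>discrete_harmonic M V (k + 1). l2_inner M \<gamma> l1 = 0)"

definition Pi_op ::
    "('m, 'n::{finite,linorder}) manifold_data \<Rightarrow> (nat \<Rightarrow> 'n form set) \<Rightarrow> nat \<Rightarrow> 'n form \<Rightarrow> 'n form"
  where
  "Pi_op M V k \<phi> = (SOME l0. \<exists>l1 l2 h. mixed_solution M V k \<phi> l0 l1 l2 h)"

text \<open>\<open>\<Pi>\<close> is an operator on equivalence classes: the component \<open>l0\<close> exists and is unique.\<close>

definition Pi_well_defined ::
    "('m, 'n::{finite,linorder}) manifold_data \<Rightarrow> (nat \<Rightarrow> 'n form set) \<Rightarrow> nat \<Rightarrow> bool" where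
  "Pi_well_defined M V k \<longleftrightarrow>
     (\<forall>\<phi>\<in>HL M k. \<exists>l0 l1 l2 h. mixed_solution M V k \<phi> l0 l1 l2 h) \<and>
     (\<forall>\<phi>\<in>HL M k. \<forall>\<phi>'\<in>HL M k. \<forall>l0 l1 l2 h l0' l1' l2' h'.
        form_eq M \<phi> \<phi>' \<and> mixed_solution M V k \<phi> l0 l1 l2 h \<and>
        mixed_solution M V k \<phi>' l0' l1' l2' h' \<longrightarrow> form_eq M l0 l0')"

definition projection_onto ::
    "('m, 'n::finite) manifold_data \<Rightarrow> ('n form \<Rightarrow> 'n form) \<Rightarrow> 'n form set \<Rightarrow> 'n form set \<Rightarrow> bool" where
  "projection_onto M P X Y \<longleftrightarrow>
     (\<forall>\<phi>\<in>X. P \<phi> \<in> Y) \<and>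
     (\<forall>\<phi>\<in>X. \<forall>\<psi>\<in>X. form_eq M \<phi> \<psi> \<longrightarrow> form_eq M (P \<phi>) (P \<psi>)) \<and>
     (\<forall>\<phi>\<in>X. \<forall>\<psi>\<in>X. \<forall>a b. form_eq M (P (lin_form a \<phi> b \<psi>)) (lin_form a (P \<phi>) b (P \<psi>))) \<and>
     (\<forall>l\<in>Y. \<exists>\<phi>\<in>X. form_eq M (P \<phi>) l) \<and>
     (\<forall>\<phi>\<in>X. form_eq M (P (P \<phi>)) (P \<phi>))"

end

theory Submission
  imports Defs "HOL-Library.Function_Algebras"
begin

text \<open>
Write \<open>(\<cdot>, \<cdot>)\<close> for the \<open>L\<^sup>2\<close> inner product and \<open>d\<close> for the exterior derivative.  The mixed system is
\<open>A(p, u) = F(p)\<close> for all \<open>p\<close> in the finite-dimensional space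
\<open>V k \<times> V (k+1) \<times> V (k+2) \<times> H\<close>, with \<open>H\<close> the discrete harmonic forms of degree \<open>k+1\<close>, a symmetric
bilinear form \<open>A\<close> and a linear functional \<open>F\<close> depending linearly on the datum.  Everything follows
from the solutions \<open>(l0, l1, l2, h)\<close> for the datum zero.  Testing the four equations with \<open>l0\<close>,
\<open>l1\<close>, \<open>l2\<close>, \<open>h\<close> yields in turn \<open>(l0, l0) = - (d l0, l1)\<close>,
\<open>(d l0, l1) = - (d l1, l2) - (l1, h)\<close>, \<open>(d l1, l2) = 0\<close>, \<open>(h, l1) = 0\<close>.  So \<open>l0\<close> vanishes.
The first equation then makes \<open>l1\<close> orthogonal to \<open>d (V k)\<close>, the third one, tested with \<open>d l1\<close>,
makes it closed, so it is harmonic and, by the fourth one, orthogonal to itself: \<open>l1\<close> vanishes as well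
(lemma \<open>homogeneous_solution_null\<close>).

Uniqueness of \<open>l0\<close> is immediate.  For existence, \<open>F(p)\<close> involves only the first two components
of \<open>p\<close>, so \<open>F\<close> vanishes on the radical of \<open>A\<close>; a functional on a finite-dimensional space that vanishes on the
radical of a symmetric form is represented by that form (lemma \<open>symmetric_form_represents\<close>).  For
discrete \<open>\<lambda>\<close>, the tuple \<open>(\<lambda>, 0, 0, 0)\<close> solves the system with datum \<open>\<lambda>\<close>, so \<open>\<Pi>\<close> fixes the
discrete space, and it is a linear projection because solutions depend linearly on the datum.

This uses two facts of analysis about forms that are functions modulo null sets.

The inner product is definite.  Pointwise, a \<open>g\<close>-orthonormal frame turns \<open>\<alpha> \<and> \<star>\<beta>\<close> into a sum of
products of the pulled back coefficients; the functoriality of pullback is the Cauchy-Binet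
formula.  Globally, the inner product only sees the disjoint pieces of the charts, and vanishing on
the pieces is carried to whole charts by the transition maps, which preserve null sets; the boundary
of a chart image is null because it lies in a Lipschitz graph.

The weak exterior derivative is unique, hence linear, up to null sets.  This is the fundamental lemma
of the calculus of variations, for which smooth bump functions are built from \<open>exp (- 1 / t)\<close>.
\<close>

section \<open>Minors and the Cauchy-Binet formula\<close>

abbreviation nth_elem :: "'a::linorder set \<Rightarrow> nat \<Rightarrow> 'a" where
  "nth_elem K r \<equiv> sorted_list_of_set K ! r"

lemma bij_nth_elem:
  fixes K :: "'n::{finite,linorder} set"
  shows "bij_betw (nth_elem K) {..<card K} K"
  by (rule bij_betw_nth) auto

text \<open>
  The minor whose rows are chosen by an arbitrary function \<open>f\<close>, in any order and possibly with
  repetitions.  These are the terms that appear when the minor of a product is expanded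
  multilinearly; they are alternating in \<open>f\<close>.
\<close>

definition row_choice_minor :: "'n::{finite,linorder} matrix \<Rightarrow> (nat \<Rightarrow> 'n) \<Rightarrow> 'n set \<Rightarrow> real" where
  "row_choice_minor B f J =
     (\<Sum>p | p permutes {..<card J}. of_int (sign p) * (\<Prod>r<card J. B $ f r $ nth_elem J (p r)))"

lemma row_choice_minor_nth: "card K = card J \<Longrightarrow> row_choice_minor B (nth_elem K) J = minor B K J"
  by (simp add: row_choice_minor_def minor_def)

lemma row_choice_minor_cong:
  "(\<And>r. r < card J \<Longrightarrow> f r = f' r) \<Longrightarrow> row_choice_minor B f J = row_choice_minor B f' J"
  unfolding row_choice_minor_def by (intro sum.cong prod.cong arg_cong2[where f="(*)"]) auto

lemma row_choice_minor_permute: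
  assumes s: "s permutes {..<card J}"
  shows "row_choice_minor B (f \<circ> s) J = of_int (sign s) * row_choice_minor B f J"
proof -
  let ?S = "{..<card J}"
  have "row_choice_minor B (f \<circ> s) J =
      (\<Sum>p | p permutes ?S. of_int (sign (p \<circ> s)) * (\<Prod>r\<in>?S. B $ f (s r) $ nth_elem J (p (s r))))"
    unfolding row_choice_minor_def by (subst sum_permutations_compose_right[OF s]) simp
  also have "\<dots> = (\<Sum>p | p permutes ?S. of_int (sign s) * (of_int (sign p) * (\<Prod>r\<in>?S. B $ f r $ nth_elem J (p r))))"
  proof (intro sum.cong refl)
    fix p assume p: "p \<in> {p. p permutes ?S}"
    have "(\<Prod>r\<in>?S. B $ f (s r) $ nth_elem J (p (s r))) = (\<Prod>r\<in>?S. B $ f r $ nth_elem J (p r))"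
      using prod.permute[OF s, of "\<lambda>r. B $ f r $ nth_elem J (p r)"] by (simp add: comp_def)
    moreover have "sign (p \<circ> s) = sign p * sign s"
      using p s by (intro sign_compose) (auto simp: permutation_permutes)
    ultimately show "of_int (sign (p \<circ> s)) * (\<Prod>r\<in>?S. B $ f (s r) $ nth_elem J (p (s r))) =
      of_int (sign s) * (of_int (sign p) * (\<Prod>r\<in>?S. B $ f r $ nth_elem J (p r)))"
      by simp
  qed
  finally show ?thesis
    by (simp add: row_choice_minor_def sum_distrib_left)
qed

text \<open>
  Exchanging two equal rows both changes the sign and leaves the minor as it is.
\<close>

lemma row_choice_minor_eq_0:
  assumes "\<not> inj_on f {..<card J}"
  shows "row_choice_minor B f J = 0"
proof -
  obtain a b where ab: "a < card J" "b < card J" "a \<noteq> b" "f a = f b"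
    using assms by (auto simp: inj_on_def)
  let ?t = "Transposition.transpose a b"
  have "f \<circ> ?t = f"
    using ab by (auto simp: fun_eq_iff Transposition.transpose_def)
  moreover have "?t permutes {..<card J}"
    using ab by (intro permutes_swap_id) auto
  ultimately have "row_choice_minor B f J = of_int (sign ?t) * row_choice_minor B f J"
    using row_choice_minor_permute[of ?t J B f] by simp
  then show ?thesis
    using ab by (simp add: sign_swap_id)
qed

text \<open>
  Multilinear expansion yields a sum over all row choices.  Those with a repetition drop out, and an
  injective one is the increasing enumeration of its image \<open>K\<close> composed with a permutation; the
  signs of these permutations assemble the first factor \<open>minor A I K\<close>.
\<close>

theorem Cauchy_Binet:
  fixes A B :: "'n::{finite,linorder} matrix"
  assumes "card I = card J"
  shows "minor (A ** B) I J = (\<Sum>K | card K = card I. minor A I K * minor B K J)"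
proof -
  define k where "k = card I"
  let ?S = "{..<k}"
  let ?F = "?S \<rightarrow>\<^sub>E (UNIV :: 'n set)"
  let ?G = "\<lambda>f. (\<Prod>r\<in>?S. A $ nth_elem I r $ f r) * row_choice_minor B f J"
  let ?inj = "{f \<in> ?F. inj_on f ?S}"
  have fin: "finite ?F" by (intro finite_PiE) auto
  have "minor (A ** B) I J = (\<Sum>p | p permutes ?S. of_int (sign p) *
        (\<Sum>f\<in>?F. \<Prod>r\<in>?S. A $ nth_elem I r $ f r * B $ f r $ nth_elem J (p r)))"
    unfolding minor_def k_def matrix_matrix_mult_def by (simp add: prod_sum_PiE)
  also have "\<dots> = (\<Sum>f\<in>?F. ?G f)"
    unfolding row_choice_minor_def using assms
    by (simp add: sum_distrib_left prod.distrib k_def mult_ac) (rule sum.swap)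
  also have "\<dots> = (\<Sum>f\<in>?inj. ?G f)"
  proof (rule sum.mono_neutral_right[OF fin])
    show "?inj \<subseteq> ?F" by (rule Collect_restrict)
    show "\<forall>f\<in>?F - ?inj. ?G f = 0"
      using row_choice_minor_eq_0[of _ J B] assms by (simp add: k_def)
  qed
  also have "\<dots> = (\<Sum>K | card K = k. \<Sum>f | f \<in> ?inj \<and> f ` ?S = K. ?G f)"
  proof -
    have "(\<lambda>f. f ` ?S) ` ?inj \<subseteq> {K. card K = k}"
    proof (rule image_subsetI)
      fix f assume "f \<in> ?inj"
      then have "card (f ` ?S) = card ?S" by (intro card_image) (simp only: mem_Collect_eq)
      then show "f ` ?S \<in> {K. card K = k}" by simp
    qed
    from sum.group[OF finite_subset[OF Collect_restrict fin] finite this, of ?G]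
    show ?thesis by (rule sym)
  qed
  also have "\<dots> = (\<Sum>K | card K = k. minor A I K * minor B K J)"
  proof (intro sum.cong refl)
    fix K :: "'n set" assume "K \<in> {K. card K = k}"
    then have K: "card K = k" by simp
    have bK: "bij_betw (nth_elem K) ?S K" using bij_nth_elem[of K] K by simp
    let ?e = "\<lambda>s. restrict (nth_elem K \<circ> s) ?S"
    have "bij_betw ?e {s. s permutes ?S} {f \<in> ?inj. f ` ?S = K}"
    proof (rule bij_betwI')
      fix s t assume st: "s \<in> {s. s permutes ?S}" "t \<in> {s. s permutes ?S}"
      show "(?e s = ?e t) = (s = t)"
      proof
        assume e: "?e s = ?e t"
        show "s = t"
        proof
          fix x
          show "s x = t x"
          proof (cases "x \<in> ?S")
            case True
            then have "nth_elem K (s x) = nth_elem K (t x)"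
              using fun_cong[OF e, of x] by simp
            moreover have "s x \<in> ?S" "t x \<in> ?S"
              using st True permutes_in_image[of s ?S x] permutes_in_image[of t ?S x] by auto
            ultimately show ?thesis
              using bK unfolding bij_betw_def inj_on_def by blast
          next
            case False then show ?thesis using st permutes_not_in by (metis mem_Collect_eq)
          qed
        qed
      qed simp
    next
      fix s assume "s \<in> {s. s permutes ?S}"
      then have "bij_betw (nth_elem K \<circ> s) ?S K"
        using bK permutes_imp_bij bij_betw_trans by blast
      then have "bij_betw (?e s) ?S K"
        by (subst bij_betw_cong[where g="nth_elem K \<circ> s"]) auto
      then show "?e s \<in> {f \<in> ?inj. f ` ?S = K}"
        by (auto simp: bij_betw_def)
    next
      fix f assume f: "f \<in> {f \<in> ?inj. f ` ?S = K}"
      define s where "s = (\<lambda>r. if r \<in> ?S then inv_into ?S (nth_elem K) (f r) else r)"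
      have "bij_betw f ?S K" using f by (auto simp: bij_betw_def)
      then have "bij_betw (inv_into ?S (nth_elem K) \<circ> f) ?S ?S"
        using bij_betw_inv_into[OF bK] bij_betw_trans by blast
      then have "bij_betw s ?S ?S"
        by (subst bij_betw_cong[where g="inv_into ?S (nth_elem K) \<circ> f"]) (auto simp: s_def)
      then have "s permutes ?S"
        by (rule bij_imp_permutes) (simp add: s_def)
      moreover have "f = ?e s"
      proof
        fix r show "f r = ?e s r"
        proof (cases "r \<in> ?S")
          case True
          then have "f r \<in> nth_elem K ` ?S" using f bK by (auto simp: bij_betw_def)
          then show ?thesis using True by (simp add: s_def f_inv_into_f)
        next
          case False then show ?thesis using f by (auto simp: PiE_def extensional_def)
        qed
      qed
      ultimately show "\<exists>s\<in>{s. s permutes ?S}. f = ?e s" by blast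
    qed
    then have "(\<Sum>f | f \<in> ?inj \<and> f ` ?S = K. ?G f) = (\<Sum>s | s permutes ?S. ?G (?e s))"
      by (subst sum.reindex_bij_betw[symmetric]) auto
    also have "\<dots> = (\<Sum>s | s permutes ?S. (\<Prod>r\<in>?S. A $ nth_elem I r $ nth_elem K (s r)) *
        (of_int (sign s) * minor B K J))"
    proof (intro sum.cong refl arg_cong2[where f="(*)"] prod.cong)
      fix s assume "s \<in> {s. s permutes ?S}"
      then have s: "s permutes {..<card J}" using assms by (simp add: k_def)
      have "row_choice_minor B (?e s) J = row_choice_minor B (nth_elem K \<circ> s) J"
        using assms by (intro row_choice_minor_cong) (simp add: k_def)
      then show "row_choice_minor B (?e s) J = of_int (sign s) * minor B K J"
        using row_choice_minor_permute[OF s] row_choice_minor_nth[of K J B] K assms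
        by (simp add: k_def)
    qed simp
    also have "\<dots> = minor A I K * minor B K J"
      unfolding minor_def[of A I K] sum_distrib_right k_def by (simp add: mult_ac)
    finally show "(\<Sum>f | f \<in> ?inj \<and> f ` ?S = K. ?G f) = minor A I K * minor B K J" .
  qed
  finally show ?thesis by (simp add: k_def)
qed

lemma minor_transpose:
  fixes A :: "'n::{finite,linorder} matrix"
  assumes "card I = card J"
  shows "minor (transpose A) J I = minor A I J"
proof -
  let ?S = "{..<card I}"
  have "minor (transpose A) J I =
      (\<Sum>p | p permutes ?S. of_int (sign p) * (\<Prod>r\<in>?S. A $ nth_elem I (p r) $ nth_elem J r))"
    unfolding minor_def transpose_def using assms by simp
  also have "\<dots> = (\<Sum>p | p permutes ?S. of_int (sign (inv p)) *
      (\<Prod>r\<in>?S. A $ nth_elem I (inv p r) $ nth_elem J r))"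
    by (subst sum_permutations_inverse) simp
  also have "\<dots> = minor A I J"
    unfolding minor_def
  proof (intro sum.cong refl arg_cong2[where f="(*)"])
    fix p assume "p \<in> {p. p permutes ?S}"
    then have p: "p permutes ?S" by simp
    show "of_int (sign (inv p)) = of_int (sign p)"
      using p by (metis finite_lessThan permutation_permutes sign_inverse)
    show "(\<Prod>r\<in>?S. A $ nth_elem I (inv p r) $ nth_elem J r) = (\<Prod>r<card I. A $ nth_elem I r $ nth_elem J (p r))"
      by (subst prod.permute[OF p]) (simp add: comp_def permutes_inverses[OF p])
  qed
  finally show ?thesis .
qed

text \<open>
  A permutation contributes only if it maps the enumeration of \<open>I\<close> to that of \<open>J\<close> entry by entry.
  This forces \<open>I = J\<close> and the permutation to be the identity.
\<close>

lemma minor_mat_1: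
  fixes I J :: "'n::{finite,linorder} set"
  assumes c: "card I = card J"
  shows "minor (mat 1) I J = (if I = J then 1 else 0)"
proof -
  let ?S = "{..<card I}"
  let ?P = "\<lambda>p. \<forall>r\<in>?S. nth_elem I r = nth_elem J (p r)"
  have m: "minor (mat 1) I J = (\<Sum>p | p permutes ?S. if ?P p then of_int (sign p) else 0)"
    unfolding minor_def
  proof (intro sum.cong refl)
    fix p
    show "of_int (sign p) * (\<Prod>r\<in>?S. mat 1 $ nth_elem I r $ nth_elem J (p r)) =
          (if ?P p then of_int (sign p) else (0::real))"
    proof (cases "?P p")
      case True then show ?thesis by (simp add: mat_def)
    next
      case False
      then obtain r where "r < card I" "nth_elem I r \<noteq> nth_elem J (p r)" by auto
      then have "(\<Prod>r\<in>?S. mat 1 $ nth_elem I r $ nth_elem J (p r)) = (0::real)"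
        by (intro prod_zero) (auto simp: mat_def intro!: bexI[of _ r])
      then show ?thesis by (simp only: False if_False mult_zero_right)
    qed
  qed
  have IJ: "nth_elem I ` ?S = I" "nth_elem J ` ?S = J"
    using bij_nth_elem[of I] bij_nth_elem[of J] c by (auto simp: bij_betw_def)
  show ?thesis
  proof (cases "I = J")
    case True
    have "?P p \<longleftrightarrow> p = id" if p: "p permutes ?S" for p
    proof
      assume P: "?P p"
      show "p = id"
      proof
        fix r show "p r = id r"
        proof (cases "r \<in> ?S")
          case r: True
          then have "p r \<in> ?S" using permutes_in_image[OF p] by blast
          then show ?thesis
            using P r bij_nth_elem[of I] True unfolding bij_betw_def inj_on_def by (metis id_apply)
        qed (use permutes_not_in[OF p] in auto)
      qed
    qed (simp add: True)
    then have "(\<Sum>p | p permutes ?S. if ?P p then of_int (sign p) else (0::real)) =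
      (\<Sum>p | p permutes ?S. if p = id then of_int (sign p) else 0)"
      by (intro sum.cong) auto
    also have "\<dots> = 1" by (simp add: finite_permutations permutes_id)
    finally show ?thesis using m True by simp
  next
    case False
    have "\<not> ?P p" if p: "p permutes ?S" for p
    proof
      assume P: "?P p"
      have "I = (\<lambda>r. nth_elem J (p r)) ` ?S"
        using image_cong[of ?S ?S "nth_elem I" "\<lambda>r. nth_elem J (p r)"] P IJ(1) by simp
      also have "\<dots> = J" using IJ(2) permutes_image[OF p] by (metis image_image)
      finally show False using False by simp
    qed
    then have "(\<Sum>p | p permutes ?S. if ?P p then of_int (sign p) else (0::real)) = 0"
      by (intro sum.neutral) auto
    then show ?thesis using m False by simp
  qed
qed

text \<open>
  Contravariant functoriality of pullback.  It makes pullback by an invertible matrix injective,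
  which is where definiteness of the pointwise inner product comes from.
\<close>

lemma pullback_covector_mult:
  "pullback_covector A (pullback_covector B a) = pullback_covector (B ** A) a"
proof
  fix J
  have "pullback_covector A (pullback_covector B a) J =
      (\<Sum>K | card K = card J. \<Sum>I | card I = card J. minor B I K * minor A K J * a I)"
    by (auto simp: pullback_covector_def sum_distrib_left mult_ac intro!: sum.cong)
  also have "\<dots> = (\<Sum>I | card I = card J. minor (B ** A) I J * a I)"
    by (subst sum.swap, intro sum.cong refl) (simp add: Cauchy_Binet sum_distrib_right)
  finally show "pullback_covector A (pullback_covector B a) J = pullback_covector (B ** A) a J"
    by (simp add: pullback_covector_def)
qed

lemma pullback_covector_zero: "pullback_covector A (\<lambda>I. 0) = (\<lambda>I. 0)"
  by (simp add: pullback_covector_def fun_eq_iff)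

lemma pullback_covector_mat_1: "pullback_covector (mat 1) a = a"
proof
  fix J
  have "pullback_covector (mat 1) a J = (\<Sum>I | card I = card J. if I = J then a I else 0)"
    unfolding pullback_covector_def by (intro sum.cong refl) (simp add: minor_mat_1)
  then show "pullback_covector (mat 1) a J = a J" by simp
qed

section \<open>The pointwise inner product of covectors\<close>

definition pos_def :: "real^'n^'n \<Rightarrow> bool" where
  "pos_def g \<longleftrightarrow> transpose g = g \<and> (\<forall>v. v \<noteq> 0 \<longrightarrow> v \<bullet> (g *v v) > 0)"

text \<open>
  Gram-Schmidt for the inner product \<open>v \<bullet> (g *v w)\<close>, by induction on the set of column indices:
  fewer than \<open>CARD('n)\<close> columns do not span the space, so a further vector exists, from which
  the projections to the previous columns are subtracted.
\<close>

lemma orthonormal_frame_exists: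
  fixes g :: "real^'n^'n"
  assumes "pos_def g"
  obtains Q :: "real^'n^'n" where "transpose Q ** g ** Q = mat 1"
proof -
  have sym: "x \<bullet> (g *v y) = y \<bullet> (g *v x)" for x y
    by (metis assms dot_lmul_matrix inner_commute pos_def_def vector_transpose_matrix)
  have pos: "v \<noteq> 0 \<Longrightarrow> v \<bullet> (g *v v) > 0" for v
    using assms by (simp add: pos_def_def)
  have frame: "\<exists>q. \<forall>i\<in>S. \<forall>j\<in>S. q i \<bullet> (g *v q j) = (if i = j then 1 else 0)"
    if "finite S" for S :: "'n set"
    using that
  proof induction
    case (insert s S)
    then obtain q :: "'n \<Rightarrow> real^'n" where
      q: "\<forall>i\<in>S. \<forall>j\<in>S. q i \<bullet> (g *v q j) = (if i = j then 1 else 0)" by blast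
    \<comment> \<open>The vectors constructed so far do not span the whole space.\<close>
    have "card (q ` S) < CARD('n)"
      using insert.hyps card_image_le[of S q] psubset_card_mono[of UNIV S] by fastforce
    then have "dim (q ` S) < DIM(real^'n)"
      using dim_le_card'[of "q ` S"] insert.hyps by auto
    then have "span (q ` S) \<noteq> UNIV"
      by (metis dim_UNIV dim_span less_irrefl)
    then obtain v where v: "v \<notin> span (q ` S)" by blast
    define w where "w = v - (\<Sum>i\<in>S. (v \<bullet> (g *v q i)) *\<^sub>R q i)"
    have "w \<noteq> 0"
    proof
      assume "w = 0"
      then have "v = (\<Sum>i\<in>S. (v \<bullet> (g *v q i)) *\<^sub>R q i)" by (simp add: w_def)
      then have "v \<in> span (q ` S)" by (metis (no_types, lifting) imageI span_base span_scale span_sum)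
      then show False using v by blast
    qed
    have w_orth: "w \<bullet> (g *v q j) = 0" if "j \<in> S" for j
    proof -
      have "(\<Sum>i\<in>S. (v \<bullet> (g *v q i)) *\<^sub>R q i) \<bullet> (g *v q j) =
          (\<Sum>i\<in>S. if i = j then v \<bullet> (g *v q i) else 0)"
        unfolding inner_sum_left by (intro sum.cong refl) (use q that in auto)
      then show ?thesis using that insert.hyps by (simp add: w_def inner_diff_left)
    qed
    define u where "u = (1 / sqrt (w \<bullet> (g *v w))) *\<^sub>R w"
    have "u \<bullet> (g *v u) = 1"
      using pos[OF \<open>w \<noteq> 0\<close>] by (simp add: u_def matrix_vector_mult_scaleR)
    moreover have "u \<bullet> (g *v q j) = 0" "q j \<bullet> (g *v u) = 0" if "j \<in> S" for j
      using w_orth[OF that] sym[of "q j" u] by (simp_all add: u_def)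
    ultimately show ?case
      using q insert.hyps by (intro exI[of _ "q(s := u)"]) auto
  qed simp
  obtain q :: "'n \<Rightarrow> real^'n" where
    "\<forall>i\<in>UNIV. \<forall>j\<in>UNIV. q i \<bullet> (g *v q j) = (if i = j then 1 else 0)"
    using frame[OF finite_class.finite_UNIV] by (elim exE)
  then have q: "q i \<bullet> (g *v q j) = (if i = j then 1 else 0)" for i j by simp
  let ?Q = "\<chi> i j. q j $ i"
  have "(transpose ?Q ** (g ** ?Q)) $ i $ j = q i \<bullet> (g *v q j)" for i j
    by (simp add: matrix_matrix_mult_def transpose_def inner_vec_def matrix_vector_mult_def)
  then have "transpose ?Q ** g ** ?Q = mat 1"
    by (simp add: vec_eq_iff q mat_def matrix_mul_assoc)
  then show ?thesis by (rule that)
qed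

lemma matrix_inv_eqI:
  fixes A B :: "real^'n^'n"
  assumes "A ** B = mat 1" and "B ** A = mat 1"
  shows "matrix_inv A = B"
proof -
  have "matrix_inv A ** A = mat 1"
    unfolding matrix_inv_def by (rule someI2[of _ B]) (use assms in auto)
  then show ?thesis
    by (metis assms(1) matrix_mul_assoc matrix_mul_lid matrix_mul_rid)
qed

lemma orthonormal_frame:
  fixes g Q :: "real^'n^'n"
  assumes Q: "transpose Q ** g ** Q = mat 1"
  shows "matrix_inv g = Q ** transpose Q" and "det g > 0" and "Q ** (transpose Q ** g) = mat 1"
proof -
  show 1: "Q ** (transpose Q ** g) = mat 1"
    using Q matrix_left_right_inverse by blast
  have "(Q ** transpose Q) ** g = mat 1"
    using 1 by (simp add: matrix_mul_assoc)
  then have "g ** (Q ** transpose Q) = mat 1" "(Q ** transpose Q) ** g = mat 1"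
    using matrix_left_right_inverse by blast+
  then show "matrix_inv g = Q ** transpose Q"
    by (rule matrix_inv_eqI)
  have "det Q * det g * det Q = 1"
    using arg_cong[OF Q, of det] by (simp add: det_mul)
  then have "(det Q)\<^sup>2 * det g = 1" by (simp add: power2_eq_square mult_ac)
  then show "det g > 0" by (smt (verit) zero_le_power2 mult_nonneg_nonpos)
qed

lemma shuffle_sign_square: "shuffle_sign I J * shuffle_sign I J = 1"
  by (simp add: shuffle_sign_def flip: power_add mult_2)

text \<open>
  The two shuffle signs, of the wedge product and of the star, are equal and cancel.
\<close>

lemma wedge_hodge_star:
  "wedge a (hodge_star g b) UNIV = sqrt (det g) * (\<Sum>I\<in>UNIV. a I * raise_indices g b I)"
proof -
  have "wedge a (hodge_star g b) UNIV =
      (\<Sum>I\<in>UNIV. (shuffle_sign I (- I) * shuffle_sign I (- I)) * (sqrt (det g) * (a I * raise_indices g b I)))"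
    unfolding wedge_def hodge_star_def
    by (intro sum.cong) (auto simp: Compl_eq_Diff_UNIV[symmetric] mult_ac)
  then show ?thesis by (simp add: shuffle_sign_square sum_distrib_left)
qed

text \<open>
  In a \<open>g\<close>-orthonormal frame the inner product of covectors is the standard one.  Since
  \<open>g\<^sup>-\<^sup>1 = Q Q\<^sup>T\<close>, raising indices is pullback by \<open>Q\<close> followed by pullback by \<open>Q\<^sup>T\<close>, and the
  latter is the adjoint of the former.  Symmetry, positivity and the bound below are read off from this
  formula.
\<close>

lemma wedge_hodge_star_frame:
  assumes Q: "transpose Q ** g ** Q = mat 1"
  shows "wedge a (hodge_star g b) UNIV =
    sqrt (det g) * (\<Sum>K\<in>UNIV. pullback_covector Q a K * pullback_covector Q b K)"
proof -
  have raise: "raise_indices g b = pullback_covector (transpose Q) (pullback_covector Q b)"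
  proof -
    have "raise_indices g b = pullback_covector (matrix_inv g) b"
      unfolding raise_indices_def pullback_covector_def
    proof (intro ext sum.cong refl arg_cong2[where f="(*)"])
      fix I J :: "'a set" assume "J \<in> {J. card J = card I}"
      then have "card J = card I" by simp
      moreover have "transpose (matrix_inv g) = matrix_inv g"
        by (simp add: orthonormal_frame[OF Q] matrix_transpose_mul)
      ultimately show "minor (matrix_inv g) I J = minor (matrix_inv g) J I"
        using minor_transpose[of J I "matrix_inv g"] by simp
    qed
    then show ?thesis
      by (simp add: orthonormal_frame[OF Q] pullback_covector_mult)
  qed
  have "(\<Sum>I\<in>UNIV. a I * pullback_covector (transpose Q) c I) = (\<Sum>K\<in>UNIV. pullback_covector Q a K * c K)" for c
  proof -
    have "(\<Sum>I\<in>UNIV. a I * pullback_covector (transpose Q) c I) =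
        (\<Sum>I\<in>UNIV. \<Sum>K | K \<in> UNIV \<and> card K = card I. minor Q I K * a I * c K)"
      unfolding pullback_covector_def sum_distrib_left
      by (intro sum.cong refl) (auto simp: minor_transpose)
    also have "\<dots> = (\<Sum>K\<in>UNIV. \<Sum>I | I \<in> UNIV \<and> card K = card I. minor Q I K * a I * c K)"
      by (rule sum.swap_restrict) auto
    also have "\<dots> = (\<Sum>K\<in>UNIV. pullback_covector Q a K * c K)"
      unfolding pullback_covector_def sum_distrib_right by (intro sum.cong refl) auto
    finally show ?thesis .
  qed
  then show ?thesis by (simp add: wedge_hodge_star raise)
qed

lemma wedge_hodge_star_commute:
  assumes "pos_def g"
  shows "wedge a (hodge_star g b) UNIV = wedge b (hodge_star g a) UNIV"
proof -
  obtain Q :: "'a matrix" where "transpose Q ** g ** Q = mat 1" using orthonormal_frame_exists[OF assms] .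
  from wedge_hodge_star_frame[OF this] show ?thesis by (simp add: mult.commute)
qed

lemma wedge_hodge_star_nonneg:
  assumes "pos_def g"
  shows "wedge a (hodge_star g a) UNIV \<ge> 0"
proof -
  obtain Q :: "'a matrix" where Q: "transpose Q ** g ** Q = mat 1" using orthonormal_frame_exists[OF assms] .
  show ?thesis
    unfolding wedge_hodge_star_frame[OF Q] using orthonormal_frame(2)[OF Q]
    by (intro mult_nonneg_nonneg[OF _ sum_nonneg]) auto
qed

text \<open>
  The sum of squares vanishes only if the pullback by \<open>Q\<close> does; pulling back by
  \<open>Q\<^sup>-\<^sup>1 = Q\<^sup>T g\<close> recovers the covector.
\<close>

lemma wedge_hodge_star_eq_0:
  assumes "pos_def g" and "wedge a (hodge_star g a) UNIV = 0"
  shows "a = (\<lambda>I. 0)"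
proof -
  obtain Q :: "'a matrix" where Q: "transpose Q ** g ** Q = mat 1" using orthonormal_frame_exists[OF assms(1)] .
  have "(\<Sum>K\<in>UNIV. pullback_covector Q a K * pullback_covector Q a K) = 0"
    using assms(2) orthonormal_frame(2)[OF Q] by (simp add: wedge_hodge_star_frame[OF Q])
  then have "pullback_covector Q a = (\<lambda>K. 0)"
    by (subst (asm) sum_nonneg_eq_0_iff) auto
  moreover have "pullback_covector (transpose Q ** g) (pullback_covector Q a) = a"
    by (simp add: pullback_covector_mult orthonormal_frame(3)[OF Q] pullback_covector_mat_1)
  ultimately show ?thesis by (metis pullback_covector_zero)
qed

text \<open>
  A Cauchy-Schwarz inequality, with the arithmetic mean in place of the geometric one and without
  its factor \<open>1 / 2\<close>.  It gives integrability and summability of mixed pairings.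
\<close>

lemma wedge_hodge_star_bound:
  assumes "pos_def g"
  shows "\<bar>wedge a (hodge_star g b) UNIV\<bar> \<le>
    wedge a (hodge_star g a) UNIV + wedge b (hodge_star g b) UNIV"
proof -
  obtain Q :: "'a matrix" where Q: "transpose Q ** g ** Q = mat 1" using orthonormal_frame_exists[OF assms] .
  have *: "\<bar>x * y\<bar> \<le> x * x + y * y" for x y :: real
    using sum_squares_bound[of "\<bar>x\<bar>" "\<bar>y\<bar>"] mult_nonneg_nonneg[of "\<bar>x\<bar>" "\<bar>y\<bar>"]
    unfolding abs_mult power2_eq_square abs_mult_self_eq by linarith
  have "\<bar>\<Sum>K\<in>UNIV. pullback_covector Q a K * pullback_covector Q b K\<bar> \<le>
      (\<Sum>K\<in>UNIV. pullback_covector Q a K * pullback_covector Q a K + pullback_covector Q b K * pullback_covector Q b K)"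
    by (rule order_trans[OF sum_abs sum_mono[OF *]])
  then show ?thesis
    using orthonormal_frame(2)[OF Q]
    by (simp add: wedge_hodge_star_frame[OF Q] abs_mult sum.distrib flip: distrib_left)
qed

section \<open>Smooth bump functions\<close>

text \<open>
  On the whole space, derivatives are unique, so the one in the definition of \<open>Ck_on\<close> does not
  depend on the order of differentiability.
\<close>

lemma Ck_on_Suc_iff:
  "Ck_on (Suc k) f UNIV \<longleftrightarrow>
    (\<forall>x. f differentiable (at x)) \<and> (\<forall>v. Ck_on k (\<lambda>x. frechet_derivative f (at x) v) UNIV)"
proof
  assume "Ck_on (Suc k) f UNIV"
  then obtain f' where f': "\<forall>x. (f has_derivative f' x) (at x)" "\<forall>v. Ck_on k (\<lambda>x. f' x v) UNIV"
    by auto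
  then have "f' x = frechet_derivative f (at x)" for x by (simp add: frechet_derivative_at)
  with f' show "(\<forall>x. f differentiable (at x)) \<and> (\<forall>v. Ck_on k (\<lambda>x. frechet_derivative f (at x) v) UNIV)"
    by (auto simp: differentiable_def)
next
  assume *: "(\<forall>x. f differentiable (at x)) \<and> (\<forall>v. Ck_on k (\<lambda>x. frechet_derivative f (at x) v) UNIV)"
  then show "Ck_on (Suc k) f UNIV"
    by (auto intro!: exI[of _ "\<lambda>x. frechet_derivative f (at x)"] simp: frechet_derivative_works)
qed

lemma Ck_on_Suc_I:
  assumes "\<And>x. (f has_derivative f' x) (at x)" and "\<And>v. Ck_on k (\<lambda>x. f' x v) UNIV"
  shows "Ck_on (Suc k) f UNIV"
  using assms by auto

lemma Ck_on_SucD: "Ck_on (Suc k) f UNIV \<Longrightarrow> Ck_on k f UNIV"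
proof (induction k arbitrary: f)
  case 0
  then show ?case
    by (auto intro!: continuous_at_imp_continuous_on dest: has_derivative_continuous)
next
  case (Suc k)
  from Suc.prems have "Ck_on k (\<lambda>x. frechet_derivative f (at x) v) UNIV" for v
    using Suc.IH unfolding Ck_on_Suc_iff[of "Suc k" f] by blast
  with Suc.prems show ?case unfolding Ck_on_Suc_iff by blast
qed

lemma Ck_on_const: "Ck_on k (\<lambda>x. c) UNIV"
proof (induction k arbitrary: c)
  case (Suc k)
  show ?case by (rule Ck_on_Suc_I[of _ "\<lambda>x v. 0"]) (auto intro: Suc)
qed auto

lemma Ck_on_bounded_linear:
  assumes "bounded_linear f"
  shows "Ck_on k f UNIV"
proof (cases k)
  case 0
  then show ?thesis using assms by (simp add: linear_continuous_on)
next
  case (Suc k)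
  then show ?thesis
    using assms by (auto intro!: Ck_on_Suc_I[of _ "\<lambda>x. f"] Ck_on_const bounded_linear_imp_has_derivative
      simp del: Ck_on.simps)
qed

lemma Ck_on_add:
  assumes "Ck_on k f UNIV" "Ck_on k g UNIV"
  shows "Ck_on k (\<lambda>x. f x + g x) UNIV"
  using assms
proof (induction k arbitrary: f g)
  case 0 then show ?case by (auto intro: continuous_intros)
next
  case (Suc k)
  from Suc.prems show ?case
    by (intro Ck_on_Suc_I[of _ "\<lambda>x v. frechet_derivative f (at x) v + frechet_derivative g (at x) v"] Suc.IH)
      (auto simp: Ck_on_Suc_iff frechet_derivative_works simp del: Ck_on.simps intro!: has_derivative_add)
qed

lemma Ck_on_mult:
  fixes f g :: "'a::real_normed_vector \<Rightarrow> real"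
  assumes "Ck_on k f UNIV" "Ck_on k g UNIV"
  shows "Ck_on k (\<lambda>x. f x * g x) UNIV"
  using assms
proof (induction k arbitrary: f g)
  case 0 then show ?case by (auto intro: continuous_intros)
next
  case (Suc k)
  show ?case
  proof (rule Ck_on_Suc_I)
    show "((\<lambda>x. f x * g x) has_derivative
        (\<lambda>v. f x * frechet_derivative g (at x) v + frechet_derivative f (at x) v * g x)) (at x)" for x
      using Suc.prems unfolding Ck_on_Suc_iff frechet_derivative_works
      by (intro has_derivative_mult) auto
    show "Ck_on k (\<lambda>x. f x * frechet_derivative g (at x) v + frechet_derivative f (at x) v * g x) UNIV" for v
      using Suc.prems Suc.prems[THEN Ck_on_SucD] unfolding Ck_on_Suc_iff
      by (intro Ck_on_add Suc.IH) auto
  qed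
qed

lemma Ck_on_prod:
  fixes f :: "'i \<Rightarrow> 'a::real_normed_vector \<Rightarrow> real"
  assumes "\<And>i. i \<in> I \<Longrightarrow> Ck_on k (f i) UNIV"
  shows "Ck_on k (\<lambda>x. \<Prod>i\<in>I. f i x) UNIV"
  using assms
  by (induction I rule: infinite_finite_induct) (auto intro: Ck_on_mult Ck_on_const)

lemma Ck_on_compose:
  fixes f :: "'a::real_normed_vector \<Rightarrow> real" and h :: "real \<Rightarrow> real"
  assumes "\<And>k. Ck_on k h UNIV" "Ck_on k f UNIV"
  shows "Ck_on k (\<lambda>x. h (f x)) UNIV"
  using assms
proof (induction k arbitrary: h)
  case 0
  have "continuous_on UNIV h" using "0.prems"(1)[of 0] by simp
  then show ?case using "0.prems" continuous_on_compose2 by (metis Ck_on.simps(1) subset_UNIV)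
next
  case (Suc k)
  let ?h' = "\<lambda>t. frechet_derivative h (at t) 1"
  have h': "(h has_derivative (\<lambda>v. ?h' t * v)) (at t)" for t
  proof -
    have "(h has_derivative frechet_derivative h (at t)) (at t)"
      using Suc.prems(1)[of 1] unfolding One_nat_def Ck_on_Suc_iff frechet_derivative_works by blast
    moreover from this have "frechet_derivative h (at t) v = ?h' t * v" for v
      using linear_scale[OF has_derivative_linear, of h _ _ v 1] by (simp add: mult.commute)
    ultimately show ?thesis by (metis (no_types, lifting) ext)
  qed
  show ?case
  proof (rule Ck_on_Suc_I)
    show "((\<lambda>x. h (f x)) has_derivative (\<lambda>v. ?h' (f x) * frechet_derivative f (at x) v)) (at x)" for x
      using Suc.prems(2) unfolding Ck_on_Suc_iff frechet_derivative_works
      by (intro has_derivative_compose[of f _ x UNIV h, simplified] h') auto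
    have "Ck_on k ?h' UNIV" for k
      using Suc.prems(1)[of "Suc k"] unfolding Ck_on_Suc_iff by blast
    then show "Ck_on k (\<lambda>x. ?h' (f x) * frechet_derivative f (at x) v) UNIV" for v
      using Suc.prems(2) Suc.IH[of ?h'] Ck_on_SucD[of k f] unfolding Ck_on_Suc_iff
      by (intro Ck_on_mult) auto
  qed
qed

lemma Ck_on_DERIV:
  fixes f f' :: "real \<Rightarrow> real"
  assumes "\<And>t. (f has_real_derivative f' t) (at t)" and "Ck_on k f' UNIV"
  shows "Ck_on (Suc k) f UNIV"
  using assms by (intro Ck_on_Suc_I[of _ "\<lambda>t v. f' t * v"] Ck_on_mult Ck_on_const)
    (auto simp: has_field_derivative_def)

lemma Ck_on_exp: "Ck_on k (exp :: real \<Rightarrow> real) UNIV"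
proof (induction k)
  case (Suc k)
  then show ?case by (intro Ck_on_DERIV[of exp exp] DERIV_exp)
qed (auto intro: continuous_intros)

text \<open>
  The smooth functions \<open>t\<^sup>-\<^sup>m exp (- 1 / t)\<close>, extended by zero.  The powers of \<open>t\<close> are included to
  obtain a family whose derivatives are again combinations of members of the family.
\<close>

definition flat :: "nat \<Rightarrow> real \<Rightarrow> real" where
  "flat m t = (if t \<le> 0 then 0 else exp (- 1 / t) / t ^ m)"

lemma power_over_fact_le_exp:
  fixes s :: real
  assumes "s \<ge> 0"
  shows "s ^ n / fact n \<le> exp s"
proof -
  have "(\<Sum>i\<in>{n}. s ^ i /\<^sub>R fact i) \<le> (\<Sum>i. s ^ i /\<^sub>R fact i)"
    using assms by (intro sum_le_suminf summable_exp_generic) auto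
  then show ?thesis by (simp add: exp_def divide_inverse mult.commute)
qed

text \<open>
  From \<open>exp s \<ge> s\<^sup>n / n!\<close> with \<open>s = 1 / t\<close> and \<open>n = m + 2\<close>.  The bound is quadratic so that it also
  shows the derivative at \<open>0\<close> to be \<open>0\<close>.
\<close>

lemma flat_bound: "\<bar>flat m t\<bar> \<le> fact (m + 2) * t\<^sup>2"
proof (cases "t \<le> 0")
  case False
  then have t: "t > 0" by simp
  define F :: real where "F = fact (m + 2)"
  have F: "F > 0" by (simp add: F_def)
  have "(1 / t) ^ (m + 2) / F \<le> exp (1 / t)"
    unfolding F_def using t by (intro power_over_fact_le_exp) auto
  then have "1 \<le> F * t ^ (m + 2) * exp (1 / t)"
    using t F by (simp add: power_one_over divide_le_eq mult_ac del: power_Suc)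
  then have "exp (- (1 / t)) \<le> F * t ^ (m + 2)"
    by (simp add: exp_minus inverse_eq_divide divide_le_eq)
  then have "exp (- 1 / t) / t ^ m \<le> F * t\<^sup>2"
    using t by (simp add: divide_le_eq power_add power2_eq_square mult_ac)
  then show ?thesis using t by (simp add: flat_def F_def)
qed (simp add: flat_def)

lemma flat_DERIV: "(flat m has_real_derivative (flat (m + 2) t - real m * flat (m + 1) t)) (at t)"
proof -
  consider "t < 0" | "t = 0" | "t > 0" by linarith
  then show ?thesis
  proof cases
    case 1
    have "((\<lambda>t. 0) has_real_derivative 0) (at t)" by simp
    then have "(flat m has_real_derivative 0) (at t)"
      by (rule has_field_derivative_transform_within_open[of _ _ _ "{..<0}"]) (use 1 in \<open>auto simp: flat_def\<close>)
    then show ?thesis using 1 by (simp add: flat_def)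
  next
    case 2
    have "((\<lambda>y. flat m y / y) \<longlongrightarrow> 0) (at 0)"
    proof (rule Lim_null_comparison)
      show "eventually (\<lambda>y. norm (flat m y / y) \<le> fact (m + 2) * \<bar>y\<bar>) (at 0)"
      proof (rule eventually_at_filter[THEN iffD2, OF always_eventually], intro allI impI)
        fix y :: real assume "y \<noteq> 0"
        then show "norm (flat m y / y) \<le> fact (m + 2) * \<bar>y\<bar>"
          using flat_bound[of m y] by (simp add: divide_le_eq power2_eq_square mult.assoc)
      qed
      have "((\<lambda>y. fact (m + 2) * \<bar>y\<bar>) \<longlongrightarrow> fact (m + 2) * \<bar>0::real\<bar>) (at 0)"
        by (intro tendsto_intros)
      then show "((\<lambda>y::real. fact (m + 2) * \<bar>y\<bar>) \<longlongrightarrow> 0) (at 0)" by simp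
    qed
    then show ?thesis using 2 by (simp add: has_field_derivative_iff flat_def)
  next
    case 3
    have E: "((\<lambda>t. exp (- 1 / t)) has_real_derivative (exp (- 1 / t) / t\<^sup>2)) (at t)"
      using 3 by (auto intro!: derivative_eq_intros simp: power2_eq_square)
    have alg: "(e / t\<^sup>2 * t ^ m - e * (real m * t ^ (m - 1))) / (t ^ m * t ^ m) =
        e / t ^ (m + 2) - real m * (e / t ^ (m + 1))" for e
      using 3 by (cases m) (simp_all add: field_simps power2_eq_square)
    have "((\<lambda>t. exp (- 1 / t) / t ^ m) has_real_derivative
        (exp (- 1 / t) / t\<^sup>2 * t ^ m - exp (- 1 / t) * (real m * t ^ (m - 1))) / (t ^ m * t ^ m)) (at t)"
      using 3 DERIV_pow[of m t] by (intro DERIV_divide E) auto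
    then have "((\<lambda>t. exp (- 1 / t) / t ^ m) has_real_derivative (flat (m + 2) t - real m * flat (m + 1) t)) (at t)"
      unfolding alg using 3 by (simp add: flat_def)
    then show ?thesis
      by (rule has_field_derivative_transform_within_open[of _ _ _ "{0<..}"]) (use 3 in \<open>auto simp: flat_def\<close>)
  qed
qed

lemma Ck_on_flat: "Ck_on k (flat m) UNIV"
proof (induction k arbitrary: m)
  case 0
  show ?case using flat_DERIV[THEN DERIV_isCont] by (auto intro: continuous_at_imp_continuous_on)
next
  case (Suc k)
  have "Ck_on k (\<lambda>t. flat (m + 2) t + (- real m) * flat (m + 1) t) UNIV"
    by (intro Ck_on_add Ck_on_mult Ck_on_const Suc.IH)
  then show ?case using flat_DERIV by (intro Ck_on_DERIV[of "flat m"]) auto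
qed

lemma flat_nonneg: "flat 0 t \<ge> 0"
  by (simp add: flat_def)

definition box_bump :: "'a::euclidean_space \<Rightarrow> 'a \<Rightarrow> 'a \<Rightarrow> real" where
  "box_bump a b x = (\<Prod>i\<in>Basis. flat 0 (x \<bullet> i - a \<bullet> i) * flat 0 (b \<bullet> i - x \<bullet> i))"

lemma box_bump_nonneg: "box_bump a b x \<ge> 0"
  by (simp add: box_bump_def flat_nonneg prod_nonneg)

lemma box_bump_eq_0_iff: "box_bump a b x = 0 \<longleftrightarrow> x \<notin> box a b"
  by (auto simp: box_bump_def box_def flat_def not_less)

lemma Ck_on_box_bump: "Ck_on k (box_bump a b) UNIV"
proof -
  have l: "Ck_on k (\<lambda>x. c * (x \<bullet> i) + d) UNIV" for k c d and i :: 'a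
    by (intro Ck_on_add Ck_on_const Ck_on_bounded_linear bounded_linear_const_mult bounded_linear_inner_left)
  have "Ck_on k (\<lambda>x. \<Prod>i\<in>Basis. flat 0 (1 * (x \<bullet> i) + - (a \<bullet> i)) * flat 0 (- 1 * (x \<bullet> i) + b \<bullet> i)) UNIV"
    by (intro Ck_on_prod Ck_on_mult Ck_on_compose[OF Ck_on_flat] l)
  then show ?thesis by (simp add: box_bump_def[abs_def] algebra_simps)
qed

text \<open>
  If \<open>u\<close> is smooth, positive in the box and zero outside, then \<open>1 - exp (- m u)\<close> is smooth with values
  in \<open>[0, 1)\<close>, vanishes outside the box, and tends to \<open>1\<close> inside as \<open>m\<close> grows.
\<close>

lemma test_functions_tendsto_indicator_box:
  fixes a b :: "'a::euclidean_space"
  assumes "cbox a b \<subseteq> W"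
  obtains \<psi> :: "nat \<Rightarrow> 'a \<Rightarrow> real" where
    "\<And>m. test_function W (\<psi> m)"
    "\<And>m x. \<bar>\<psi> m x\<bar> \<le> indicator (box a b) x"
    "\<And>x. (\<lambda>m. \<psi> m x) \<longlonglongrightarrow> indicator (box a b) x"
proof
  define \<psi> where "\<psi> m x = 1 - exp (- (real m * box_bump a b x))" for m x
  have out: "\<psi> m x = 0" if "x \<notin> box a b" for m x
    using that by (simp add: \<psi>_def flip: box_bump_eq_0_iff)
  show "test_function W (\<psi> m)" for m
  proof -
    have "Ck_on k (\<lambda>x. 1 + - 1 * exp (- real m * box_bump a b x)) UNIV" for k
      by (intro Ck_on_add Ck_on_mult Ck_on_const Ck_on_compose[OF Ck_on_exp] Ck_on_box_bump)
    then have "smooth_on UNIV (\<psi> m)"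
      by (simp add: smooth_on_def \<psi>_def[abs_def])
    moreover have "closure {x. \<psi> m x \<noteq> 0} \<subseteq> cbox a b"
      using out box_subset_cbox[of a b] by (intro closure_minimal) auto
    moreover from this have "compact (closure {x. \<psi> m x \<noteq> 0})"
      using bounded_subset[OF bounded_cbox] by (auto simp: compact_eq_bounded_closed)
    ultimately show ?thesis using assms by (auto simp: test_function_def)
  qed
  show "\<bar>\<psi> m x\<bar> \<le> indicator (box a b) x" for m x
    using out[of x m] box_bump_nonneg[of a b x] by (cases "x \<in> box a b") (auto simp: \<psi>_def)
  show "(\<lambda>m. \<psi> m x) \<longlonglongrightarrow> indicator (box a b) x" for x
  proof (cases "x \<in> box a b")
    case True
    then have u: "box_bump a b x > 0"
      using box_bump_eq_0_iff[of a b x] box_bump_nonneg[of a b x] by linarith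
    have "(\<lambda>m. exp (- box_bump a b x) ^ m) \<longlonglongrightarrow> 0"
      using u by (intro LIMSEQ_realpow_zero) auto
    then have "(\<lambda>m. 1 - exp (- box_bump a b x) ^ m) \<longlonglongrightarrow> 1 - 0"
      by (rule tendsto_diff[OF tendsto_const])
    moreover have "exp (- box_bump a b x) ^ m = exp (- (real m * box_bump a b x))" for m
      using exp_of_nat_mult[of m "- box_bump a b x"] by simp
    ultimately show ?thesis using True by (simp add: \<psi>_def)
  next
    case False then show ?thesis using out by simp
  qed
qed

section \<open>The fundamental lemma of the calculus of variations\<close>

lemma continuous_on_test_function:
  assumes "test_function W \<psi>"
  shows "continuous_on UNIV \<psi>"
  using assms unfolding test_function_def smooth_on_def by (metis Ck_on.simps(1))

lemma test_function_eq_0: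
  "x \<notin> closure {x. \<psi> x \<noteq> 0} \<Longrightarrow> \<psi> x = 0"
  using closure_subset[of "{x. \<psi> x \<noteq> 0}"] by auto

text \<open>
  Lebesgue differentiation: almost everywhere, the value of \<open>f\<close> is the limit of its means over small
  cubes.
\<close>

lemma AE_eq_0_if_cbox_integrals_eq_0:
  fixes f :: "'a::euclidean_space \<Rightarrow> real"
  assumes "\<And>c d. f integrable_on cbox c d" and "\<And>c d. integral (cbox c d) f = 0"
  shows "AE x in lebesgue. f x = 0"
proof -
  obtain N where "negligible N" and
    N: "\<And>x e. \<lbrakk>x \<notin> N; 0 < e\<rbrakk> \<Longrightarrow> \<exists>d>0. \<forall>h. 0 < h \<and> h < d \<longrightarrow>
          norm (integral (cbox x (x + h *\<^sub>R One)) f /\<^sub>R h ^ DIM('a) - f x) < e"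
    using integrable_ccontinuous_explicit[OF assms(1)] by blast
  have "f x = 0" if x: "x \<notin> N" for x
  proof (rule ccontr)
    assume "f x \<noteq> 0"
    then obtain d where "d > 0" "\<forall>h. 0 < h \<and> h < d \<longrightarrow>
          norm (integral (cbox x (x + h *\<^sub>R One)) f /\<^sub>R h ^ DIM('a) - f x) < \<bar>f x\<bar>"
      using N[OF x, of "\<bar>f x\<bar>"] by auto
    then have "norm (integral (cbox x (x + (d / 2) *\<^sub>R One)) f /\<^sub>R (d / 2) ^ DIM('a) - f x) < \<bar>f x\<bar>"
      by simp
    then show False by (simp add: assms(2))
  qed
  then show ?thesis
    using \<open>negligible N\<close> by (intro AE_I'[of N]) (auto simp: negligible_iff_null_sets)
qed

lemma integral_box_eq_0_if_test_integrals_eq_0: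
  fixes b :: "'a::euclidean_space \<Rightarrow> real"
  assumes int: "set_integrable lebesgue (cbox c d) b" and W: "cbox c d \<subseteq> W"
    and test: "\<And>\<psi>. test_function W \<psi> \<Longrightarrow> (LINT x:W|lebesgue. b x * \<psi> x) = 0"
  shows "integral (cbox c d) b = 0"
proof -
  obtain \<psi> where \<psi>: "\<And>m. test_function W (\<psi> m)"
    "\<And>m x. \<bar>\<psi> m x\<bar> \<le> indicator (box c d) x"
    "\<And>x. (\<lambda>m. \<psi> m x) \<longlonglongrightarrow> indicator (box c d) x"
    using test_functions_tendsto_indicator_box[OF W] by blast
  let ?f = "\<lambda>x. indicator (cbox c d) x *\<^sub>R b x"
  have f: "integrable lebesgue ?f" using int by (simp add: set_integrable_def)
  have meas: "\<psi> m \<in> borel_measurable lebesgue" for m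
    using continuous_on_test_function[OF \<psi>(1)] by (simp add: borel_measurable_continuous_onI measurable_completion)
  have supp: "\<psi> m x = 0" if "x \<notin> box c d" for m x
    using \<psi>(2)[of m x] that by simp
  have eq: "indicator W x *\<^sub>R (b x * \<psi> m x) = ?f x * \<psi> m x" for m x
    using supp[of x m] W box_subset_cbox[of c d] by (cases "x \<in> box c d") (auto simp: indicator_def)
  have "(\<lambda>m. LINT x|lebesgue. ?f x * \<psi> m x) \<longlonglongrightarrow> (LINT x|lebesgue. ?f x * indicator (box c d) x)"
  proof (rule integral_dominated_convergence[where w="\<lambda>x. norm (?f x)"])
    have "(\<lambda>x. indicator (box c d) x :: real) \<in> borel_measurable lebesgue"
      by (intro borel_measurable_indicator fmeasurableD lmeasurable_box)
    then show "(\<lambda>x. ?f x * indicator (box c d) x) \<in> borel_measurable lebesgue"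
      using f by (intro borel_measurable_times) auto
    show "(\<lambda>x. ?f x * \<psi> m x) \<in> borel_measurable lebesgue" for m
      using f meas by (intro borel_measurable_times) auto
    show "integrable lebesgue (\<lambda>x. norm (?f x))" using f by (rule integrable_norm)
    show "AE x in lebesgue. (\<lambda>m. ?f x * \<psi> m x) \<longlonglongrightarrow> ?f x * indicator (box c d) x"
      using \<psi>(3) by (intro AE_I2 tendsto_mult tendsto_const)
    have "\<bar>\<psi> m x\<bar> \<le> 1" for m x
      using order_trans[OF \<psi>(2)] by (simp add: indicator_le_1)
    then show "AE x in lebesgue. norm (?f x * \<psi> m x) \<le> norm (?f x)" for m
      by (intro AE_I2) (simp add: abs_mult mult_left_le)
  qed
  moreover have "(LINT x|lebesgue. ?f x * \<psi> m x) = 0" for m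
    using test[OF \<psi>(1)[of m]] unfolding set_lebesgue_integral_def eq .
  ultimately have "(LINT x|lebesgue. ?f x * indicator (box c d) x) = 0"
    by (simp add: LIMSEQ_const_iff)
  moreover have "(\<lambda>x. ?f x * indicator (box c d) x) = (\<lambda>x. indicator (box c d) x *\<^sub>R b x)"
    using box_subset_cbox[of c d] by (intro ext) (auto simp: indicator_def)
  ultimately have "(LINT x:box c d|lebesgue. b x) = 0"
    by (simp add: set_lebesgue_integral_def)
  moreover have "set_integrable lebesgue (box c d) b"
    by (rule set_integrable_subset[OF int]) (auto intro: box_subset_cbox[THEN subsetD])
  ultimately show ?thesis
    by (simp add: set_lebesgue_integral_eq_integral(2) integral_open_interval)
qed

text \<open>
  Testing with functions that tend to indicators of boxes shows that the integral over every box inside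
  \<open>W\<close> is zero.  So \<open>b\<close> vanishes almost everywhere on each such box, and countably many boxes
  cover \<open>W\<close>.
\<close>

theorem AE_eq_0_if_test_integrals_eq_0:
  fixes b :: "'a::euclidean_space \<Rightarrow> real"
  assumes "open W"
    and int: "\<And>C. compact C \<Longrightarrow> C \<subseteq> W \<Longrightarrow> set_integrable lebesgue C b"
    and test: "\<And>\<psi>. test_function W \<psi> \<Longrightarrow> (LINT x:W|lebesgue. b x * \<psi> x) = 0"
  shows "AE x in lebesgue. x \<in> W \<longrightarrow> b x = 0"
proof -
  have on_cbox: "AE x in lebesgue. x \<in> cbox p q \<longrightarrow> b x = 0" if pq: "cbox p q \<subseteq> W" for p q
  proof -
    let ?f = "\<lambda>x. if x \<in> cbox p q then b x else 0"
    have sub: "integral (cbox c d) b = 0" if "cbox c d \<subseteq> W" for c d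
      by (rule integral_box_eq_0_if_test_integrals_eq_0[OF int that test]) (use that in auto)
    have "?f absolutely_integrable_on UNIV"
      unfolding absolutely_integrable_restrict_UNIV using int[OF compact_cbox pq] .
    then have "?f integrable_on cbox c d" for c d
      using integrable_on_subcbox[of ?f UNIV c d] set_lebesgue_integral_eq_integral(1) by blast
    moreover have "integral (cbox c d) ?f = 0" for c d
    proof -
      have "integral (cbox c d) ?f = integral (cbox p q \<inter> cbox c d) b"
        by (rule Henstock_Kurzweil_Integration.integral_restrict_Int)
      then show ?thesis
        using sub[of "\<Sum>i\<in>Basis. max (p \<bullet> i) (c \<bullet> i) *\<^sub>R i" "\<Sum>i\<in>Basis. min (q \<bullet> i) (d \<bullet> i) *\<^sub>R i"] pq
        by (simp add: le_infI1 flip: Int_interval)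
    qed
    ultimately have "AE x in lebesgue. ?f x = 0"
      by (rule AE_eq_0_if_cbox_integrals_eq_0)
    then show ?thesis by eventually_elim auto
  qed
  obtain D where D: "countable D" "D \<subseteq> Pow W" "\<And>X. X \<in> D \<Longrightarrow> \<exists>a b. X = cbox a b" "\<Union>D = W"
    using open_countable_Union_open_cbox[OF \<open>open W\<close>] by metis
  have "AE x in lebesgue. \<forall>X\<in>D. x \<in> X \<longrightarrow> b x = 0"
    using D(1)
  proof (rule AE_ball_countable[THEN iffD2], intro ballI)
    fix X assume X: "X \<in> D"
    then obtain p q where "X = cbox p q" using D(3) by blast
    moreover have "X \<subseteq> W" using X D(2) by blast
    ultimately show "AE x in lebesgue. x \<in> X \<longrightarrow> b x = 0" using on_cbox by simp
  qed
  then show ?thesis by eventually_elim (use D(4) in auto)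
qed

section \<open>The weak exterior derivative\<close>

lemma weak_ext_deriv_onD:
  assumes "weak_ext_deriv_on W a b"
  shows "compact C \<Longrightarrow> C \<subseteq> W \<Longrightarrow> set_integrable lebesgue C (\<lambda>x. a x I)"
    and "compact C \<Longrightarrow> C \<subseteq> W \<Longrightarrow> set_integrable lebesgue C (\<lambda>x. b x I)"
    and "test_function W \<psi> \<Longrightarrow>
      (LINT x:W|lebesgue. \<Sum>j\<in>K. shuffle_sign {j} (K - {j}) * a x (K - {j}) *
          frechet_derivative \<psi> (at x) (axis j 1)) = - (LINT x:W|lebesgue. b x K * \<psi> x)"
  using assms unfolding weak_ext_deriv_on_def by simp_all

text \<open>
  A locally integrable function times a continuous function with compact support is integrable.  This
  is needed because the Bochner integral is additive only on integrable functions.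
\<close>

lemma weak_ext_deriv_term_integrable:
  fixes W :: "'n::{finite,linorder} point set"
  assumes W: "weak_ext_deriv_on W a b" "open W" and \<psi>: "test_function W \<psi>"
  shows "set_integrable lebesgue W (\<lambda>x. \<Sum>j\<in>K. shuffle_sign {j} (K - {j}) * a x (K - {j}) *
            frechet_derivative \<psi> (at x) (axis j 1))" (is ?A)
    and "set_integrable lebesgue W (\<lambda>x. b x K * \<psi> x)" (is ?B)
proof -
  let ?C = "closure {x. \<psi> x \<noteq> 0}"
  have C: "compact ?C" "?C \<subseteq> W" using \<psi> by (auto simp: test_function_def)
  have gen: "set_integrable lebesgue W (\<lambda>x. f x * \<theta> x)"
    if f: "set_integrable lebesgue ?C f" and \<theta>: "continuous_on UNIV \<theta>" "\<And>x. x \<notin> ?C \<Longrightarrow> \<theta> x = 0"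
    for f \<theta> :: "'n point \<Rightarrow> real"
  proof -
    obtain B where B: "\<And>x. x \<in> ?C \<Longrightarrow> norm (\<theta> x) \<le> B"
      using compact_imp_bounded[OF compact_continuous_image[OF continuous_on_subset[OF \<theta>(1)] C(1)]]
      by (auto simp: bounded_iff)
    have "integrable lebesgue (\<lambda>x. (indicator ?C x *\<^sub>R f x) * \<theta> x)"
    proof (rule Bochner_Integration.integrable_bound)
      show "integrable lebesgue (\<lambda>x. B * (indicator ?C x *\<^sub>R f x))"
        using f by (simp add: set_integrable_def)
      show "(\<lambda>x. indicator ?C x *\<^sub>R f x * \<theta> x) \<in> borel_measurable lebesgue"
        using f \<theta>(1) unfolding set_integrable_def
        by (intro borel_measurable_times) (auto simp: borel_measurable_continuous_onI measurable_completion)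
      show "AE x in lebesgue. norm (indicator ?C x *\<^sub>R f x * \<theta> x) \<le> norm (B * (indicator ?C x *\<^sub>R f x))"
      proof (rule AE_I2)
        fix x
        show "norm (indicator ?C x *\<^sub>R f x * \<theta> x) \<le> norm (B * (indicator ?C x *\<^sub>R f x))"
          using B[of x] by (cases "x \<in> ?C") (auto simp: abs_mult mult.commute intro!: mult_right_mono)
      qed
    qed
    moreover have "(\<lambda>x. indicator ?C x *\<^sub>R f x * \<theta> x) = (\<lambda>x. indicator W x *\<^sub>R (f x * \<theta> x))"
      using C(2) \<theta>(2) by (intro ext) (auto simp: indicator_def)
    ultimately show ?thesis by (simp add: set_integrable_def)
  qed
  have ab: "set_integrable lebesgue ?C (\<lambda>x. a x I)" "set_integrable lebesgue ?C (\<lambda>x. b x I)" for I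
    using weak_ext_deriv_onD(1,2)[OF W(1) C] by this+
  show ?B
    by (rule gen[OF ab(2) continuous_on_test_function[OF \<psi>]]) (rule test_function_eq_0)
  have C1: "Ck_on (Suc 0) \<psi> UNIV" using \<psi> unfolding test_function_def smooth_on_def by blast
  have cont: "continuous_on UNIV (\<lambda>x. frechet_derivative \<psi> (at x) v)" for v
    using C1 unfolding Ck_on_Suc_iff by simp
  have zero: "frechet_derivative \<psi> (at x) v = 0" if "x \<notin> ?C" for x v
  proof -
    have "((\<lambda>x. 0) has_derivative (\<lambda>v. 0)) (at x)" by simp
    then have "(\<psi> has_derivative (\<lambda>v. 0)) (at x)"
    proof (rule has_derivative_transform_within_open)
      show "open (- ?C)" by (rule open_Compl) (rule closed_closure)
      show "x \<in> - ?C" using that unfolding Compl_iff .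
      show "0 = \<psi> y" if "y \<in> - ?C" for y
        using test_function_eq_0[of y \<psi>] that by (metis ComplD)
    qed
    then show ?thesis by (metis frechet_derivative_at)
  qed
  have "set_integrable lebesgue W (\<lambda>x. a x (K - {j}) *
          (shuffle_sign {j} (K - {j}) * frechet_derivative \<psi> (at x) (axis j 1)))" for j
    by (rule gen[OF ab(1)]) (use zero in \<open>auto intro!: continuous_intros cont\<close>)
  then show ?A
    unfolding set_integrable_def scaleR_sum_right
    by (intro Bochner_Integration.integrable_sum) (simp add: mult_ac)
qed

lemma weak_ext_deriv_on_lin:
  fixes W :: "'n::{finite,linorder} point set"
  assumes W: "open W" and 1: "weak_ext_deriv_on W a b" and 2: "weak_ext_deriv_on W a' b'"
  shows "weak_ext_deriv_on W (\<lambda>x I. s * a x I + t * a' x I) (\<lambda>x I. s * b x I + t * b' x I)"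
  unfolding weak_ext_deriv_on_def
proof (intro conjI allI impI)
  fix C I assume C: "compact C \<and> C \<subseteq> W"
  have "set_integrable lebesgue C (\<lambda>x. a x I)" "set_integrable lebesgue C (\<lambda>x. b x I)"
    "set_integrable lebesgue C (\<lambda>x. a' x I)" "set_integrable lebesgue C (\<lambda>x. b' x I)"
    using C weak_ext_deriv_onD(1,2)[OF 1, of C I] weak_ext_deriv_onD(1,2)[OF 2, of C I] by simp_all
  then show "set_integrable lebesgue C (\<lambda>x. s * a x I + t * a' x I)"
    "set_integrable lebesgue C (\<lambda>x. s * b x I + t * b' x I)"
    by (simp_all only: set_integral_add(1) set_integrable_mult_right)
next
  fix \<psi> K assume \<psi>: "test_function W \<psi>"
  let ?A = "\<lambda>a x. \<Sum>j\<in>K. shuffle_sign {j} (K - {j}) * a x (K - {j}) * frechet_derivative \<psi> (at x) (axis j 1)"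
  have int: "set_integrable lebesgue W (?A a)" "set_integrable lebesgue W (?A a')"
      "set_integrable lebesgue W (\<lambda>x. b x K * \<psi> x)" "set_integrable lebesgue W (\<lambda>x. b' x K * \<psi> x)"
    using weak_ext_deriv_term_integrable[OF 1 W \<psi>] weak_ext_deriv_term_integrable[OF 2 W \<psi>] by blast+
  have eq: "(LINT x:W|lebesgue. ?A a x) = - (LINT x:W|lebesgue. b x K * \<psi> x)"
      "(LINT x:W|lebesgue. ?A a' x) = - (LINT x:W|lebesgue. b' x K * \<psi> x)"
    by (rule weak_ext_deriv_onD(3)[OF 1 \<psi>] weak_ext_deriv_onD(3)[OF 2 \<psi>])+
  have "(LINT x:W|lebesgue. ?A (\<lambda>x I. s * a x I + t * a' x I) x) = (LINT x:W|lebesgue. s * ?A a x + t * ?A a' x)"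
    by (simp add: algebra_simps sum.distrib sum_distrib_left)
  also have "\<dots> = s * (LINT x:W|lebesgue. ?A a x) + t * (LINT x:W|lebesgue. ?A a' x)"
    using int by (simp only: set_integral_add(2) set_integral_mult_right set_integrable_mult_right)
  also have "\<dots> = - (s * (LINT x:W|lebesgue. b x K * \<psi> x) + t * (LINT x:W|lebesgue. b' x K * \<psi> x))"
    unfolding eq by simp
  also have "s * (LINT x:W|lebesgue. b x K * \<psi> x) + t * (LINT x:W|lebesgue. b' x K * \<psi> x) =
      (LINT x:W|lebesgue. s * (b x K * \<psi> x) + t * (b' x K * \<psi> x))"
    using int by (simp only: set_integral_add(2) set_integral_mult_right set_integrable_mult_right)
  finally show "(LINT x:W|lebesgue. ?A (\<lambda>x I. s * a x I + t * a' x I) x) =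
      - (LINT x:W|lebesgue. (s * b x K + t * b' x K) * \<psi> x)"
    by (simp add: algebra_simps)
qed

text \<open>
  Together with linearity, this is the uniqueness of the weak exterior derivative.
\<close>

lemma weak_ext_deriv_on_zero:
  fixes W :: "'n::{finite,linorder} point set"
  assumes W: "open W" and wd: "weak_ext_deriv_on W a b"
    and a: "AE x in lebesgue. x \<in> W \<longrightarrow> a x = (\<lambda>I. 0)"
  shows "AE x in lebesgue. x \<in> W \<longrightarrow> b x = (\<lambda>I. 0)"
proof -
  have "AE x in lebesgue. x \<in> W \<longrightarrow> b x K = 0" for K
  proof (rule AE_eq_0_if_test_integrals_eq_0[OF W])
    show "set_integrable lebesgue C (\<lambda>x. b x K)" if "compact C" "C \<subseteq> W" for C
      using that by (rule weak_ext_deriv_onD(2)[OF wd])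
    fix \<psi> :: "'n point \<Rightarrow> real" assume "test_function W \<psi>"
    then have "(LINT x:W|lebesgue. b x K * \<psi> x) =
       - (LINT x:W|lebesgue. \<Sum>j\<in>K. shuffle_sign {j} (K - {j}) * a x (K - {j}) * frechet_derivative \<psi> (at x) (axis j 1))"
      by (simp add: weak_ext_deriv_onD(3)[OF wd])
    also have "\<dots> = 0"
      unfolding set_lebesgue_integral_def neg_equal_0_iff_equal
    proof (rule integral_eq_zero_AE)
      show "AE x in lebesgue. indicator W x *\<^sub>R (\<Sum>j\<in>K. shuffle_sign {j} (K - {j}) * a x (K - {j}) *
          frechet_derivative \<psi> (at x) (axis j 1)) = 0"
        using a by eventually_elim (simp add: indicator_def)
    qed
    finally show "(LINT x:W|lebesgue. b x K * \<psi> x) = 0" .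
  qed
  then have "AE x in lebesgue. \<forall>K. x \<in> W \<longrightarrow> b x K = 0"
    by (subst AE_all_countable) blast
  then show ?thesis by eventually_elim auto
qed

section \<open>Null sets in charts\<close>

lemma lipschitz_epigraph_closed:
  fixes S :: "'a::euclidean_space set"
  assumes "lipschitz_epigraph S"
  shows "closed S"
proof -
  obtain u f L where f: "L-lipschitz_on UNIV f" and S: "S = {x. f (x - (x \<bullet> u) *\<^sub>R u) \<le> x \<bullet> u}"
    using assms unfolding lipschitz_epigraph_def by blast
  have "continuous_on UNIV (\<lambda>x. f (x - (x \<bullet> u) *\<^sub>R u))"
    by (intro continuous_on_compose2[OF lipschitz_on_continuous_on[OF f]] continuous_intros) auto
  then show ?thesis
    unfolding S by (intro closed_Collect_le continuous_intros)
qed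

text \<open>
  The graph is the image of the hyperplane orthogonal to \<open>u\<close> under a Lipschitz map.
\<close>

lemma negligible_lipschitz_graph:
  fixes u :: "'a::euclidean_space"
  assumes f: "L-lipschitz_on UNIV f" and u: "norm u = 1"
  shows "negligible {x. f (x - (x \<bullet> u) *\<^sub>R u) = x \<bullet> u}"
proof -
  let ?P = "{y. u \<bullet> y = 0}"
  let ?g = "\<lambda>y. y + f y *\<^sub>R u"
  have "negligible (?g ` ?P)"
  proof (rule negligible_locally_Lipschitz_image)
    show "negligible ?P" using u by (intro negligible_hyperplane) auto
    show "\<exists>T B. open T \<and> x \<in> T \<and> (\<forall>y\<in>?P \<inter> T. norm (?g y - ?g x) \<le> B * norm (y - x))" for x
    proof (intro exI[of _ UNIV] exI[of _ "1 + L"] conjI ballI)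
      fix y assume "y \<in> ?P \<inter> UNIV"
      have "norm (?g y - ?g x) = norm ((y - x) + (f y - f x) *\<^sub>R u)"
        by (simp add: algebra_simps)
      also have "\<dots> \<le> norm (y - x) + norm ((f y - f x) *\<^sub>R u)" by (rule norm_triangle_ineq)
      also have "norm ((f y - f x) *\<^sub>R u) \<le> L * norm (y - x)"
        using lipschitz_onD[OF f, of y x] u by (simp add: dist_norm)
      finally show "norm (?g y - ?g x) \<le> (1 + L) * norm (y - x)" by (simp add: distrib_right)
    qed auto
  qed simp
  moreover have "{x. f (x - (x \<bullet> u) *\<^sub>R u) = x \<bullet> u} \<subseteq> ?g ` ?P"
  proof
    fix x assume x: "x \<in> {x. f (x - (x \<bullet> u) *\<^sub>R u) = x \<bullet> u}"
    have "u \<bullet> u = 1" using u by (simp add: norm_eq_1)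
    then have "x - (x \<bullet> u) *\<^sub>R u \<in> ?P" by (simp add: inner_diff_right inner_commute)
    moreover have "x = ?g (x - (x \<bullet> u) *\<^sub>R u)" using x by simp
    ultimately show "x \<in> ?g ` ?P" by (rule rev_image_eqI)
  qed
  ultimately show ?thesis by (rule negligible_subset)
qed

text \<open>
  The points strictly above the graph form an open set, so the boundary points that belong to \<open>T\<close>
  lie on the graph.
\<close>

lemma negligible_openin_epigraph_boundary:
  fixes S :: "'a::euclidean_space set"
  assumes S: "lipschitz_epigraph S" and T: "openin (top_of_set S) T"
  shows "negligible (T - interior T)"
proof -
  obtain u f L where u: "norm u = 1" and f: "L-lipschitz_on UNIV f"
    and Seq: "S = {x. f (x - (x \<bullet> u) *\<^sub>R u) \<le> x \<bullet> u}"
    using S unfolding lipschitz_epigraph_def by blast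
  obtain U where U: "open U" "T = S \<inter> U" using T unfolding openin_open by blast
  let ?S' = "{x. f (x - (x \<bullet> u) *\<^sub>R u) < x \<bullet> u}"
  have "continuous_on UNIV (\<lambda>x. f (x - (x \<bullet> u) *\<^sub>R u))"
    by (intro continuous_on_compose2[OF lipschitz_on_continuous_on[OF f]] continuous_intros) auto
  then have "open ?S'" by (intro open_Collect_less continuous_intros)
  then have "open (?S' \<inter> U)" using U(1) by (rule open_Int)
  moreover have "?S' \<inter> U \<subseteq> T" unfolding U(2) Seq by auto
  ultimately have "?S' \<inter> U \<subseteq> interior T" by (intro interior_maximal)
  then have "T - interior T \<subseteq> {x. f (x - (x \<bullet> u) *\<^sub>R u) = x \<bullet> u}"
    unfolding U(2) Seq by force
  then show ?thesis using negligible_lipschitz_graph[OF f u] negligible_subset by blast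
qed

lemma openin_closed_sets_lebesgue:
  fixes S :: "'a::euclidean_space set"
  assumes "closed S" "openin (top_of_set S) T"
  shows "T \<in> sets lebesgue"
  using assms unfolding openin_open by (auto intro!: sets.Int)

lemma smooth_up_to_differentiable_on:
  assumes "smooth_up_to S f"
  shows "f differentiable_on S"
  unfolding differentiable_on_def
proof
  fix x assume x: "x \<in> S"
  then obtain V F where V: "open V" "x \<in> V" "smooth_on V F" "\<And>y. y \<in> V \<inter> S \<Longrightarrow> F y = f y"
    using assms unfolding smooth_up_to_def by meson
  from V(3) have "Ck_on (Suc 0) F V" unfolding smooth_on_def by blast
  then obtain F' where "\<forall>x\<in>V. (F has_derivative F' x) (at x)" unfolding Ck_on.simps by blast
  then have "(F has_derivative F' x) (at x within S)"
    using V(2) has_derivative_at_withinI by blast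
  then have F: "F differentiable (at x within S)" by (rule differentiableI)
  obtain d where d: "d > 0" "ball x d \<subseteq> V" using V(1,2) open_contains_ball by blast
  show "f differentiable (at x within S)"
    by (rule differentiable_transform_within[OF F d(1) x])
      (use V(4) d(2) in \<open>auto simp: dist_commute subset_iff\<close>)
qed

lemma AE_lebesgue_iff_negligible:
  "(AE x in lebesgue. P x) \<longleftrightarrow> negligible {x. \<not> P x}" for P :: "'a::euclidean_space \<Rightarrow> bool"
proof
  assume "AE x in lebesgue. P x"
  then obtain N where "N \<in> null_sets lebesgue" "{x. \<not> P x} \<subseteq> N"
    unfolding eventually_ae_filter by auto
  then show "negligible {x. \<not> P x}"
    using negligible_subset negligible_iff_null_sets by metis
next
  assume "negligible {x. \<not> P x}"
  then show "AE x in lebesgue. P x"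
    by (intro AE_I'[of "{x. \<not> P x}"]) (simp_all add: negligible_iff_null_sets)
qed

locale riemannian_manifold =
  fixes M :: "('m, 'n::{finite,linorder}) manifold_data"
  assumes manifold: "lipschitz_riemannian_manifold M"
begin

lemma dom_of_subset: "dom_of M i \<subseteq> topspace (top_of M)"
  using manifold unfolding lipschitz_riemannian_manifold_def by blast

lemma chart_homeomorphic:
  "homeomorphic_map (subtopology (top_of M) (dom_of M i)) (top_of_set (img_of M i)) (chart_of M i)"
  using manifold unfolding lipschitz_riemannian_manifold_def by blast

lemma topspace_chart: "topspace (subtopology (top_of M) (dom_of M i)) = dom_of M i"
  using dom_of_subset by auto

lemma inj_on_chart: "inj_on (chart_of M i) (dom_of M i)"
  using homeomorphic_imp_injective_map[OF chart_homeomorphic] unfolding topspace_chart .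

lemma openin_dom: "openin (top_of M) (dom_of M i)"
  using manifold unfolding lipschitz_riemannian_manifold_def by blast

lemma openin_overlap: "openin (top_of_set (img_of M i)) (overlap M i j)"
proof -
  have "openin (subtopology (top_of M) (dom_of M i)) (dom_of M i \<inter> dom_of M j)"
    using openin_dom by (simp add: openin_subtopology_Int2)
  moreover have "dom_of M i \<inter> dom_of M j \<subseteq> topspace (subtopology (top_of M) (dom_of M i))"
    unfolding topspace_chart by (rule Int_lower1)
  ultimately show ?thesis
    unfolding overlap_def using homeomorphic_map_openness[OF chart_homeomorphic] by blast
qed

lemma img_in_epigraph:
  obtains S where "lipschitz_epigraph S" "openin (top_of_set S) (img_of M i)"
proof -
  have "\<exists>S. lipschitz_epigraph S \<and> openin (top_of_set S) (img_of M i)"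
    using manifold unfolding lipschitz_riemannian_manifold_def by simp
  then show ?thesis using that by blast
qed

lemma sets_img: "img_of M i \<in> sets lebesgue"
proof -
  obtain S where S: "lipschitz_epigraph S" "openin (top_of_set S) (img_of M i)"
    using img_in_epigraph .
  show ?thesis
    by (rule openin_closed_sets_lebesgue[OF lipschitz_epigraph_closed[OF S(1)] S(2)])
qed

lemma sets_overlap: "overlap M i j \<in> sets lebesgue"
proof -
  obtain S where S: "lipschitz_epigraph S" "openin (top_of_set S) (img_of M i)"
    using img_in_epigraph .
  show ?thesis
    by (rule openin_closed_sets_lebesgue[OF lipschitz_epigraph_closed[OF S(1)] openin_trans[OF openin_overlap S(2)]])
qed

lemma negligible_img_boundary: "negligible (img_of M i - interior (img_of M i))"
proof -
  obtain S where S: "lipschitz_epigraph S" "openin (top_of_set S) (img_of M i)"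
    using img_in_epigraph .
  show ?thesis
    by (rule negligible_openin_epigraph_boundary[OF S])
qed

lemma negligible_overlap_boundary: "negligible (overlap M i j - interior (overlap M i j))"
proof -
  obtain S where S: "lipschitz_epigraph S" "openin (top_of_set S) (img_of M i)"
    using img_in_epigraph .
  show ?thesis
    by (rule negligible_openin_epigraph_boundary[OF S(1) openin_trans[OF openin_overlap S(2)]])
qed

lemma piece_eq: "piece M i = img_of M i - (\<Union>j<i. overlap M i j)"
proof -
  have "chart_of M i ` (dom_of M i - (\<Union>j<i. dom_of M j)) =
      chart_of M i ` dom_of M i - chart_of M i ` (dom_of M i \<inter> (\<Union>j<i. dom_of M j))"
    using inj_on_image_set_diff[OF inj_on_chart[of i], of "dom_of M i" "dom_of M i \<inter> (\<Union>j<i. dom_of M j)"]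
    by (simp add: Diff_Int)
  then show ?thesis
    by (simp only: piece_def img_of_def overlap_def Int_UN_distrib image_UN)
qed

lemma piece_subset_img: "piece M i \<subseteq> img_of M i"
  unfolding piece_eq by blast

lemma sets_piece: "piece M i \<in> sets lebesgue"
  unfolding piece_eq by (intro sets.Diff sets.finite_UN sets_img sets_overlap) auto

lemma transition_chart: "p \<in> dom_of M i \<Longrightarrow> transition M i j (chart_of M i p) = chart_of M j p"
  by (simp add: transition_def inv_into_f_f[OF inj_on_chart])

text \<open>
  Differentiable maps between spaces of the same dimension preserve null sets.
\<close>

lemma negligible_transition_image:
  assumes "negligible N" "N \<subseteq> overlap M i j"
  shows "negligible (transition M i j ` N)"
proof (rule negligible_differentiable_image_negligible[OF order_refl assms(1)])
  have "\<forall>i j. smooth_up_to (overlap M i j) (transition M i j)"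
    using manifold unfolding lipschitz_riemannian_manifold_def by (elim conjE) assumption
  then have "smooth_up_to (overlap M i j) (transition M i j)" by blast
  from smooth_up_to_differentiable_on[OF this] assms(2)
  show "transition M i j differentiable_on N"
    by (rule differentiable_on_subset)
qed

lemma metric_pos_def: "x \<in> img_of M i \<Longrightarrow> pos_def (metric_of M i x)"
proof -
  assume x: "x \<in> img_of M i"
  have "\<forall>i. \<forall>x\<in>img_of M i. transpose (metric_of M i x) = metric_of M i x \<and>
          (\<forall>v. v \<noteq> 0 \<longrightarrow> v \<bullet> (metric_of M i x *v v) > 0)"
    using manifold unfolding lipschitz_riemannian_manifold_def by (elim conjE) assumption
  from bspec[OF spec[OF this] x] show "pos_def (metric_of M i x)" unfolding pos_def_def .
qed

end

lemma L2_formsD: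
  assumes "\<omega> \<in> L2_forms M k"
  shows "card I \<noteq> k \<Longrightarrow> \<omega> i x I = 0"
    and "set_borel_measurable lebesgue (img_of M i) (\<lambda>x. \<omega> i x I)"
    and "AE x in lebesgue. x \<in> interior (overlap M i j) \<longrightarrow>
        \<omega> i x = pullback_covector (jacobian (transition M i j) (at x)) (\<omega> j (transition M i j x))"
    and "set_integrable lebesgue (piece M i) (pairing M \<omega> \<omega> i)"
    and "summable (\<lambda>i. LINT x:piece M i|lebesgue. pairing M \<omega> \<omega> i x)"
proof -
  note * = assms[unfolded L2_forms_def mem_Collect_eq]
  show "card I \<noteq> k \<Longrightarrow> \<omega> i x I = 0"
    by (rule *[THEN conjunct1, THEN spec, THEN spec, THEN spec, THEN mp])
  show "set_borel_measurable lebesgue (img_of M i) (\<lambda>x. \<omega> i x I)"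
    by (rule *[THEN conjunct2, THEN conjunct1, THEN spec, THEN spec])
  show "AE x in lebesgue. x \<in> interior (overlap M i j) \<longrightarrow>
        \<omega> i x = pullback_covector (jacobian (transition M i j) (at x)) (\<omega> j (transition M i j x))"
    by (rule *[THEN conjunct2, THEN conjunct2, THEN conjunct1, THEN spec, THEN spec])
  show "set_integrable lebesgue (piece M i) (pairing M \<omega> \<omega> i)"
    by (rule *[THEN conjunct2, THEN conjunct2, THEN conjunct2, THEN conjunct1, THEN spec])
  show "summable (\<lambda>i. LINT x:piece M i|lebesgue. pairing M \<omega> \<omega> i x)"
    by (rule *[THEN conjunct2, THEN conjunct2, THEN conjunct2, THEN conjunct2])
qed

context riemannian_manifold
begin

text \<open>
  Each point of chart \<open>i\<close> lies in the piece of exactly one chart \<open>j\<close>, namely the first one that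
  contains it.  Off a null set, the value in chart \<open>i\<close> is the pullback of the value in chart \<open>j\<close>, which
  is zero outside a null set; and that null set is mapped to a null set of chart \<open>i\<close>.  The
  compatibility of the coordinate expressions is only known in the interior of the overlap, hence its boundary
  has to be null too.
\<close>

lemma AE_img_if_AE_piece:
  assumes \<alpha>: "\<alpha> \<in> L2_forms M k"
    and 0: "\<And>j. AE x in lebesgue. x \<in> piece M j \<longrightarrow> \<alpha> j x = (\<lambda>I. 0)"
  shows "AE x in lebesgue. x \<in> img_of M i \<longrightarrow> \<alpha> i x = (\<lambda>I. 0)"
proof -
  define N where "N j = {y \<in> overlap M j i. y \<in> piece M j \<and> \<alpha> j y \<noteq> (\<lambda>I. 0)}" for j
  define E where "E j = {x \<in> interior (overlap M i j). \<alpha> i x \<noteq>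
    pullback_covector (jacobian (transition M i j) (at x)) (\<alpha> j (transition M i j x))}" for j
  let ?bad = "\<lambda>j. (overlap M i j - interior (overlap M i j)) \<union> E j \<union> transition M j i ` N j"
  have "negligible (?bad j)" for j
  proof (intro negligible_Un negligible_overlap_boundary)
    have "AE x in lebesgue. x \<in> interior (overlap M i j) \<longrightarrow>
        \<alpha> i x = pullback_covector (jacobian (transition M i j) (at x)) (\<alpha> j (transition M i j x))"
      by (rule L2_formsD(3)[OF \<alpha>])
    then show "negligible (E j)"
      unfolding AE_lebesgue_iff_negligible E_def by simp
    have "negligible (N j)"
      using 0[of j] unfolding AE_lebesgue_iff_negligible by (rule negligible_subset) (auto simp: N_def)
    then show "negligible (transition M j i ` N j)"
      by (rule negligible_transition_image) (auto simp: N_def)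
  qed
  then have "negligible (\<Union>j. ?bad j)"
    using negligible_countable_Union[of "range ?bad"] by auto
  moreover have "{x. \<not> (x \<in> img_of M i \<longrightarrow> \<alpha> i x = (\<lambda>I. 0))} \<subseteq> (\<Union>j. ?bad j)"
  proof (rule subsetI)
    fix x assume "x \<in> {x. \<not> (x \<in> img_of M i \<longrightarrow> \<alpha> i x = (\<lambda>I. 0))}"
    then have x: "x \<in> img_of M i" "\<alpha> i x \<noteq> (\<lambda>I. 0)" by simp_all
    then obtain p where p: "p \<in> dom_of M i" "x = chart_of M i p" by (auto simp: img_of_def)
    define j where "j = (LEAST j. p \<in> dom_of M j)"
    have pj: "p \<in> dom_of M j" unfolding j_def using p(1) by (rule LeastI)
    have "p \<notin> dom_of M l" if "l < j" for l using that not_less_Least unfolding j_def by blast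
    then have piece: "chart_of M j p \<in> piece M j" using pj unfolding piece_def by blast
    have ov: "x \<in> overlap M i j" "chart_of M j p \<in> overlap M j i"
      using p pj by (auto simp: overlap_def)
    have tr: "transition M i j x = chart_of M j p" "transition M j i (chart_of M j p) = x"
      using p pj by (auto simp: transition_chart)
    have "x \<in> ?bad j"
    proof (rule ccontr)
      assume "x \<notin> ?bad j"
      then have "x \<in> interior (overlap M i j)" "x \<notin> E j" "x \<notin> transition M j i ` N j" using ov by auto
      then have "\<alpha> i x = pullback_covector (jacobian (transition M i j) (at x)) (\<alpha> j (chart_of M j p))"
        "chart_of M j p \<notin> N j"
        using tr by (simp_all add: E_def) force
      moreover from this(2) have "\<alpha> j (chart_of M j p) = (\<lambda>I. 0)"
        using ov piece by (simp add: N_def)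
      ultimately show False using x(2) by (simp add: pullback_covector_zero)
    qed
    then show "x \<in> (\<Union>j. ?bad j)" by (rule UN_I[OF UNIV_I])
  qed
  ultimately show ?thesis unfolding AE_lebesgue_iff_negligible by (rule negligible_subset)
qed

end

section \<open>Measurability of the pairing\<close>

lemma borel_measurable_det:
  fixes A :: "'a \<Rightarrow> real^'n^'n"
  assumes "\<And>i j. (\<lambda>x. A x $ i $ j) \<in> borel_measurable N"
  shows "(\<lambda>x. det (A x)) \<in> borel_measurable N"
  unfolding det_def
  by (intro borel_measurable_sum borel_measurable_times borel_measurable_const borel_measurable_prod assms)

text \<open>
  Cramer's rule; it exhibits the entries of the inverse as measurable functions of the matrix.
\<close>

lemma matrix_inv_nth:
  fixes A :: "real^'n^'n"
  assumes "det A \<noteq> 0"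
  shows "matrix_inv A $ i $ j = det (\<chi> k l. if l = i then axis j 1 $ k else A $ k $ l) / det A"
proof -
  obtain B where B: "A ** B = mat 1" "B ** A = mat 1"
    using assms invertible_det_nz[of A] unfolding invertible_def by blast
  then have "matrix_inv A = B" by (rule matrix_inv_eqI)
  then have "A *v (matrix_inv A *v axis j 1) = axis j 1"
    by (simp add: matrix_vector_mul_assoc B)
  note inv_col = cramer[OF assms, THEN iffD1, OF this]
  have "matrix_inv A $ i $ j = (matrix_inv A *v axis j 1) $ i"
    by (simp add: matrix_vector_mul_component row_def inner_axis)
  also have "\<dots> = det (\<chi> k l. if l = i then axis j 1 $ k else A $ k $ l) / det A"
    by (subst inv_col) simp
  finally show ?thesis .
qed

lemma borel_measurable_matrix_inv:
  fixes A :: "'a \<Rightarrow> real^'n^'n"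
  assumes A: "\<And>i j. (\<lambda>x. A x $ i $ j) \<in> borel_measurable N"
    and det: "\<And>x. x \<in> space N \<Longrightarrow> det (A x) \<noteq> 0"
  shows "(\<lambda>x. matrix_inv (A x) $ i $ j) \<in> borel_measurable N"
proof -
  have "(\<lambda>x. det (\<chi> k l. if l = i then axis j 1 $ k else A x $ k $ l) / det (A x)) \<in> borel_measurable N"
  proof (intro borel_measurable_divide borel_measurable_det A)
    show "(\<lambda>x. (\<chi> k l. if l = i then axis j 1 $ k else A x $ k $ l) $ i' $ j') \<in> borel_measurable N" for i' j'
      by (cases "j' = i") (auto intro: A)
  qed
  then show ?thesis
    by (rule measurable_cong[THEN iffD1, rotated]) (simp add: matrix_inv_nth det)
qed

lemma borel_measurable_minor:
  fixes A :: "'a \<Rightarrow> 'n::{finite,linorder} matrix"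
  assumes "\<And>i j. (\<lambda>x. A x $ i $ j) \<in> borel_measurable N"
  shows "(\<lambda>x. minor (A x) I J) \<in> borel_measurable N"
  unfolding minor_def
  by (intro borel_measurable_sum borel_measurable_times borel_measurable_const borel_measurable_prod assms)

context riemannian_manifold
begin

lemma borel_measurable_metric:
  "(\<lambda>x. metric_of M i x $ k $ l) \<in> borel_measurable (lebesgue_on (img_of M i))"
proof -
  have "\<forall>i. smooth_up_to (img_of M i) (metric_of M i)"
    using manifold unfolding lipschitz_riemannian_manifold_def by (elim conjE) assumption
  then have "smooth_up_to (img_of M i) (metric_of M i)" by (rule spec)
  then have "continuous_on (img_of M i) (metric_of M i)"
    by (intro differentiable_imp_continuous_on smooth_up_to_differentiable_on)
  then have "continuous_on (img_of M i) (\<lambda>x. metric_of M i x $ k $ l)"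
    by (intro continuous_intros)
  then show ?thesis
    using sets_img by (rule continuous_imp_measurable_on_sets_lebesgue)
qed

lemma borel_measurable_pairing:
  assumes "\<alpha> \<in> L2_forms M k" "\<beta> \<in> L2_forms M k'"
  shows "set_borel_measurable lebesgue (piece M i) (pairing M \<alpha> \<beta> i)"
proof -
  let ?N = "lebesgue_on (img_of M i)"
  have comp: "(\<lambda>x. \<gamma> i x I) \<in> borel_measurable ?N" if "\<gamma> \<in> L2_forms M l" for \<gamma> I l
  proof -
    have "set_borel_measurable lebesgue (img_of M i) (\<lambda>x. \<gamma> i x I)"
      by (rule L2_formsD(2)[OF that])
    then show ?thesis
      using sets_img by (simp add: borel_measurable_restrict_space_iff set_borel_measurable_def)
  qed
  have det: "det (metric_of M i x) > 0" if x: "x \<in> img_of M i" for x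
  proof -
    obtain Q :: "'n matrix" where "transpose Q ** metric_of M i x ** Q = mat 1"
      using orthonormal_frame_exists[OF metric_pos_def[OF x]] .
    then show ?thesis by (rule orthonormal_frame(2))
  qed
  have "(\<lambda>x. minor (matrix_inv (metric_of M i x)) I J) \<in> borel_measurable ?N" for I J
    by (intro borel_measurable_minor borel_measurable_matrix_inv borel_measurable_metric) (use det in fastforce)
  then have "(\<lambda>x. sqrt (det (metric_of M i x)) * (\<Sum>I\<in>UNIV. \<alpha> i x I *
      (\<Sum>J | card J = card I. minor (matrix_inv (metric_of M i x)) I J * \<beta> i x J))) \<in> borel_measurable ?N"
    by (intro borel_measurable_times borel_measurable_sum comp[OF assms(1)] comp[OF assms(2)]
        borel_measurable_sqrt borel_measurable_det borel_measurable_metric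
        measurable_compose[OF _ borel_measurable_sqrt])
  then have "pairing M \<alpha> \<beta> i \<in> borel_measurable ?N"
    by (simp add: pairing_def[abs_def] wedge_hodge_star raise_indices_def)
  then have "set_borel_measurable lebesgue (img_of M i) (pairing M \<alpha> \<beta> i)"
    using sets_img by (simp add: borel_measurable_restrict_space_iff set_borel_measurable_def)
  then show ?thesis
    by (rule set_borel_measurable_subset) (use sets_piece piece_subset_img in auto)
qed

end

section \<open>The inner product of square-integrable forms\<close>

lemma pullback_covector_lin:
  "pullback_covector A (\<lambda>I. s * a I + t * b I) =
    (\<lambda>I. s * pullback_covector A a I + t * pullback_covector A b I)"
  by (simp add: pullback_covector_def fun_eq_iff algebra_simps sum.distrib sum_distrib_left)

lemma lin_form_apply: "lin_form a \<alpha> b \<beta> i x = (\<lambda>I. a * \<alpha> i x I + b * \<beta> i x I)"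
  by (simp add: lin_form_def fun_eq_iff)

lemma pairing_lin_left:
  "pairing M (lin_form a \<alpha> b \<beta>) \<gamma> i x = a * pairing M \<alpha> \<gamma> i x + b * pairing M \<beta> \<gamma> i x"
  by (simp add: pairing_def wedge_def lin_form_def algebra_simps sum.distrib sum_distrib_left)

context riemannian_manifold
begin

lemma pairing_commute: "x \<in> img_of M i \<Longrightarrow> pairing M \<alpha> \<beta> i x = pairing M \<beta> \<alpha> i x"
  unfolding pairing_def by (rule wedge_hodge_star_commute[OF metric_pos_def])

lemma pairing_nonneg: "x \<in> img_of M i \<Longrightarrow> pairing M \<alpha> \<alpha> i x \<ge> 0"
  unfolding pairing_def by (rule wedge_hodge_star_nonneg[OF metric_pos_def])

lemma pairing_bound:
  "x \<in> img_of M i \<Longrightarrow> \<bar>pairing M \<alpha> \<beta> i x\<bar> \<le> pairing M \<alpha> \<alpha> i x + pairing M \<beta> \<beta> i x"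
  unfolding pairing_def by (rule wedge_hodge_star_bound[OF metric_pos_def])

lemma pairing_lin_lin:
  assumes x: "x \<in> img_of M i"
  shows "pairing M (lin_form a \<alpha> b \<beta>) (lin_form a \<alpha> b \<beta>) i x =
    a * a * pairing M \<alpha> \<alpha> i x + (2 * a * b * pairing M \<alpha> \<beta> i x + b * b * pairing M \<beta> \<beta> i x)"
  using pairing_commute[OF x, of \<alpha> "lin_form a \<alpha> b \<beta>"] pairing_commute[OF x, of \<beta> "lin_form a \<alpha> b \<beta>"]
    pairing_commute[OF x, of \<beta> \<alpha>]
  by (simp add: pairing_lin_left algebra_simps)

lemma set_integrable_pairing:
  assumes \<alpha>: "\<alpha> \<in> L2_forms M k" and \<beta>: "\<beta> \<in> L2_forms M k"
  shows "set_integrable lebesgue (piece M i) (pairing M \<alpha> \<beta> i)"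
proof (rule set_integrable_bound)
  show "set_integrable lebesgue (piece M i) (\<lambda>x. pairing M \<alpha> \<alpha> i x + pairing M \<beta> \<beta> i x)"
    using L2_formsD(4)[OF \<alpha>] L2_formsD(4)[OF \<beta>] by (rule set_integral_add(1))
  show "set_borel_measurable lebesgue (piece M i) (pairing M \<alpha> \<beta> i)"
    using \<alpha> \<beta> by (rule borel_measurable_pairing)
  show "AE x in lebesgue. x \<in> piece M i \<longrightarrow>
      norm (pairing M \<alpha> \<beta> i x) \<le> norm (pairing M \<alpha> \<alpha> i x + pairing M \<beta> \<beta> i x)"
  proof (intro AE_I2 impI)
    fix x assume "x \<in> piece M i"
    then have "x \<in> img_of M i" using piece_subset_img by blast
    from pairing_bound[OF this, of \<alpha> \<beta>]
    show "norm (pairing M \<alpha> \<beta> i x) \<le> norm (pairing M \<alpha> \<alpha> i x + pairing M \<beta> \<beta> i x)"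
      unfolding real_norm_def by linarith
  qed
qed

abbreviation piece_inner :: "'n form \<Rightarrow> 'n form \<Rightarrow> nat \<Rightarrow> real" where
  "piece_inner \<alpha> \<beta> i \<equiv> LINT x:piece M i|lebesgue. pairing M \<alpha> \<beta> i x"

lemma summable_piece_inner:
  assumes \<alpha>: "\<alpha> \<in> L2_forms M k" and \<beta>: "\<beta> \<in> L2_forms M k"
  shows "summable (piece_inner \<alpha> \<beta>)"
proof (rule summable_comparison_test')
  show "summable (\<lambda>i. piece_inner \<alpha> \<alpha> i + piece_inner \<beta> \<beta> i)"
    using L2_formsD(5)[OF \<alpha>] L2_formsD(5)[OF \<beta>] by (rule summable_add)
  show "norm (piece_inner \<alpha> \<beta> i) \<le> piece_inner \<alpha> \<alpha> i + piece_inner \<beta> \<beta> i" for i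
  proof -
    have "norm (piece_inner \<alpha> \<beta> i) \<le> (LINT x:piece M i|lebesgue. pairing M \<alpha> \<alpha> i x + pairing M \<beta> \<beta> i x)"
      unfolding set_lebesgue_integral_def
    proof (rule Bochner_Integration.integral_norm_bound_integral)
      show "integrable lebesgue (\<lambda>x. indicator (piece M i) x *\<^sub>R pairing M \<alpha> \<beta> i x)"
        using set_integrable_pairing[OF \<alpha> \<beta>] unfolding set_integrable_def .
      show "integrable lebesgue (\<lambda>x. indicator (piece M i) x *\<^sub>R (pairing M \<alpha> \<alpha> i x + pairing M \<beta> \<beta> i x))"
        using set_integral_add(1)[OF L2_formsD(4)[OF \<alpha>] L2_formsD(4)[OF \<beta>]] unfolding set_integrable_def .
      show "norm (indicator (piece M i) x *\<^sub>R pairing M \<alpha> \<beta> i x) \<le>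
          indicator (piece M i) x *\<^sub>R (pairing M \<alpha> \<alpha> i x + pairing M \<beta> \<beta> i x)" for x
        using pairing_bound[of x i \<alpha> \<beta>] piece_subset_img[of i] by (cases "x \<in> piece M i") auto
    qed
    then show ?thesis
      by (simp only: set_integral_add(2)[OF L2_formsD(4)[OF \<alpha>] L2_formsD(4)[OF \<beta>]])
  qed
qed

lemma l2_inner_lin_left:
  assumes \<alpha>: "\<alpha> \<in> L2_forms M k" and \<beta>: "\<beta> \<in> L2_forms M k" and \<gamma>: "\<gamma> \<in> L2_forms M k"
  shows "l2_inner M (lin_form a \<alpha> b \<beta>) \<gamma> = a * l2_inner M \<alpha> \<gamma> + b * l2_inner M \<beta> \<gamma>"
proof -
  have "piece_inner (lin_form a \<alpha> b \<beta>) \<gamma> i = a * piece_inner \<alpha> \<gamma> i + b * piece_inner \<beta> \<gamma> i" for i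
    unfolding pairing_lin_left
    by (simp only: set_integral_add(2) set_integral_mult_right set_integrable_mult_right
        set_integrable_pairing[OF \<alpha> \<gamma>] set_integrable_pairing[OF \<beta> \<gamma>])
  then show ?thesis
    unfolding l2_inner_def
    by (simp only: suminf_add[symmetric] suminf_mult summable_mult
        summable_piece_inner[OF \<alpha> \<gamma>] summable_piece_inner[OF \<beta> \<gamma>])
qed

lemma l2_inner_commute: "l2_inner M \<alpha> \<beta> = l2_inner M \<beta> \<alpha>"
proof -
  have "piece_inner \<alpha> \<beta> i = piece_inner \<beta> \<alpha> i" for i
  proof (rule set_lebesgue_integral_cong[OF sets_piece], intro allI impI)
    fix x assume "x \<in> piece M i"
    then show "pairing M \<alpha> \<beta> i x = pairing M \<beta> \<alpha> i x"
      using piece_subset_img pairing_commute by blast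
  qed
  then show ?thesis unfolding l2_inner_def by simp
qed

text \<open>
  All integrals over pieces are nonnegative, so each is zero and the pairing vanishes almost
  everywhere on each piece; by pointwise definiteness so does the form.
\<close>

lemma l2_inner_eq_0_imp:
  assumes \<alpha>: "\<alpha> \<in> L2_forms M k" and 0: "l2_inner M \<alpha> \<alpha> = 0"
  shows "form_eq M \<alpha> zero_form"
proof -
  have nn: "0 \<le> indicator (piece M i) x *\<^sub>R pairing M \<alpha> \<alpha> i x" for i x
    using pairing_nonneg[of x i \<alpha>] piece_subset_img[of i] by (cases "x \<in> piece M i") auto
  have "piece_inner \<alpha> \<alpha> i \<ge> 0" for i
    unfolding set_lebesgue_integral_def by (rule integral_nonneg_AE) (rule AE_I2[OF nn])
  then have zero: "piece_inner \<alpha> \<alpha> i = 0" for i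
    using 0 suminf_eq_zero_iff[OF L2_formsD(5)[OF \<alpha>]] unfolding l2_inner_def by blast
  have "AE x in lebesgue. x \<in> piece M i \<longrightarrow> \<alpha> i x = (\<lambda>I. 0)" for i
  proof -
    have "AE x in lebesgue. indicator (piece M i) x *\<^sub>R pairing M \<alpha> \<alpha> i x = 0"
      using integral_nonneg_eq_0_iff_AE[OF L2_formsD(4)[OF \<alpha>, unfolded set_integrable_def] AE_I2[OF nn]]
        zero[of i] unfolding set_lebesgue_integral_def by blast
    then show ?thesis
    proof eventually_elim
      case (elim x)
      show ?case
      proof
        assume x: "x \<in> piece M i"
        then have "pairing M \<alpha> \<alpha> i x = 0" using elim by simp
        moreover have "pos_def (metric_of M i x)" using x piece_subset_img metric_pos_def by blast
        ultimately show "\<alpha> i x = (\<lambda>I. 0)" unfolding pairing_def by (intro wedge_hodge_star_eq_0)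
      qed
    qed
  qed
  from AE_img_if_AE_piece[OF \<alpha> this]
  show ?thesis unfolding form_eq_def zero_form_def by blast
qed

lemma l2_inner_null:
  assumes "form_eq M \<alpha> zero_form"
  shows "l2_inner M \<alpha> \<beta> = 0"
proof -
  have "piece_inner \<alpha> \<beta> i = 0" for i
    unfolding set_lebesgue_integral_def
  proof (rule integral_eq_zero_AE)
    have "AE x in lebesgue. x \<in> img_of M i \<longrightarrow> \<alpha> i x = zero_form i x"
      using assms unfolding form_eq_def by blast
    then show "AE x in lebesgue. indicator (piece M i) x *\<^sub>R pairing M \<alpha> \<beta> i x = 0"
    proof eventually_elim
      case (elim x)
      show ?case
      proof (cases "x \<in> piece M i")
        case True
        then have "\<alpha> i x = zero_form i x" using elim piece_subset_img by blast
        then show ?thesis by (simp add: pairing_def wedge_def zero_form_def)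
      qed simp
    qed
  qed
  then show ?thesis by (simp add: l2_inner_def)
qed

text \<open>
  The norm of a combination is expanded by bilinearity; its mixed term is controlled by the bound on
  the pairing.
\<close>

lemma L2_forms_lin:
  assumes \<alpha>: "\<alpha> \<in> L2_forms M k" and \<beta>: "\<beta> \<in> L2_forms M k"
  shows "lin_form a \<alpha> b \<beta> \<in> L2_forms M k"
  unfolding L2_forms_def mem_Collect_eq
proof (intro conjI allI impI)
  let ?l = "lin_form a \<alpha> b \<beta>"
  show "?l i x I = 0" if "card I \<noteq> k" for i x I
    using L2_formsD(1)[OF \<alpha> that] L2_formsD(1)[OF \<beta> that] by (simp add: lin_form_def)
  show "set_borel_measurable lebesgue (img_of M i) (\<lambda>x. ?l i x I)" for i I
  proof -
    have "(\<lambda>x. a * (indicator (img_of M i) x *\<^sub>R \<alpha> i x I) + b * (indicator (img_of M i) x *\<^sub>R \<beta> i x I))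
        \<in> borel_measurable lebesgue"
      using L2_formsD(2)[OF \<alpha>, of i I] L2_formsD(2)[OF \<beta>, of i I] unfolding set_borel_measurable_def
      by (intro borel_measurable_add borel_measurable_times borel_measurable_const)
    then show ?thesis by (simp add: set_borel_measurable_def lin_form_def algebra_simps)
  qed
  show "AE x in lebesgue. x \<in> interior (overlap M i j) \<longrightarrow>
        ?l i x = pullback_covector (jacobian (transition M i j) (at x)) (?l j (transition M i j x))" for i j
    using L2_formsD(3)[OF \<alpha>, of i j] L2_formsD(3)[OF \<beta>, of i j]
    by eventually_elim (simp add: lin_form_apply pullback_covector_lin)
  have int: "set_integrable lebesgue (piece M i) (\<lambda>x. a * a * pairing M \<alpha> \<alpha> i x)"
    "set_integrable lebesgue (piece M i) (\<lambda>x. 2 * a * b * pairing M \<alpha> \<beta> i x)"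
    "set_integrable lebesgue (piece M i) (\<lambda>x. b * b * pairing M \<beta> \<beta> i x)" for i
    by (simp_all only: set_integrable_mult_right set_integrable_pairing[OF \<alpha> \<beta>]
      set_integrable_pairing[OF \<alpha> \<alpha>] set_integrable_pairing[OF \<beta> \<beta>])
  note int' = set_integral_add(1)[OF int(1) set_integral_add(1)[OF int(2,3)]]
  have eq: "indicator (piece M i) x *\<^sub>R pairing M ?l ?l i x = indicator (piece M i) x *\<^sub>R
      (a * a * pairing M \<alpha> \<alpha> i x + (2 * a * b * pairing M \<alpha> \<beta> i x + b * b * pairing M \<beta> \<beta> i x))" for i x
    using pairing_lin_lin[of x i a \<alpha> b \<beta>] piece_subset_img[of i] by (cases "x \<in> piece M i") auto
  show "set_integrable lebesgue (piece M i) (pairing M ?l ?l i)" for i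
    unfolding set_integrable_def eq using int'[of i] unfolding set_integrable_def .
  have "piece_inner ?l ?l i =
      a * a * piece_inner \<alpha> \<alpha> i + (2 * a * b * piece_inner \<alpha> \<beta> i + b * b * piece_inner \<beta> \<beta> i)" for i
  proof -
    have "piece_inner ?l ?l i = (LINT x:piece M i|lebesgue. a * a * pairing M \<alpha> \<alpha> i x +
        (2 * a * b * pairing M \<alpha> \<beta> i x + b * b * pairing M \<beta> \<beta> i x))"
      unfolding set_lebesgue_integral_def eq ..
    then show ?thesis
      by (simp only: set_integral_add(2)[OF int(1) set_integral_add(1)[OF int(2,3)]]
        set_integral_add(2)[OF int(2,3)] set_integral_mult_right)
  qed
  then show "summable (\<lambda>i. piece_inner ?l ?l i)"
    by (simp only: summable_add summable_mult summable_piece_inner[OF \<alpha> \<beta>]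
      summable_piece_inner[OF \<alpha> \<alpha>] summable_piece_inner[OF \<beta> \<beta>])
qed

section \<open>The exterior derivative on equivalence classes\<close>

lemma is_ext_deriv_lin:
  assumes "is_ext_deriv M \<alpha> \<alpha>'" "is_ext_deriv M \<beta> \<beta>'"
  shows "is_ext_deriv M (lin_form a \<alpha> b \<beta>) (lin_form a \<alpha>' b \<beta>')"
  using assms weak_ext_deriv_on_lin[OF open_interior]
  unfolding is_ext_deriv_def lin_form_def[abs_def] by blast

text \<open>
  The weak derivative is tested in the interior of a chart image only, but the remaining points
  form a null set.
\<close>

lemma is_ext_deriv_null:
  assumes d: "is_ext_deriv M \<alpha> \<alpha>'" and 0: "form_eq M \<alpha> zero_form"
  shows "form_eq M \<alpha>' zero_form"
  unfolding form_eq_def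
proof
  fix i
  let ?W = "interior (img_of M i)"
  have "AE x in lebesgue. x \<in> img_of M i \<longrightarrow> \<alpha> i x = zero_form i x"
    using 0 unfolding form_eq_def by blast
  then have "AE x in lebesgue. x \<in> ?W \<longrightarrow> \<alpha> i x = (\<lambda>I. 0)"
    by eventually_elim (use interior_subset in \<open>auto simp: zero_form_def fun_eq_iff\<close>)
  then have "AE x in lebesgue. x \<in> ?W \<longrightarrow> \<alpha>' i x = (\<lambda>I. 0)"
    using weak_ext_deriv_on_zero[OF open_interior] d unfolding is_ext_deriv_def by blast
  moreover have "AE x in lebesgue. x \<notin> img_of M i - ?W"
    using negligible_img_boundary[of i] unfolding AE_lebesgue_iff_negligible by (simp only: not_not Collect_mem_eq)
  ultimately show "AE x in lebesgue. x \<in> img_of M i \<longrightarrow> \<alpha>' i x = zero_form i x"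
    by eventually_elim (auto simp: zero_form_def fun_eq_iff)
qed

lemma HL_subset_L2: "\<omega> \<in> HL M k \<Longrightarrow> \<omega> \<in> L2_forms M k"
  unfolding HL_def by blast

lemma ext_d:
  assumes "\<omega> \<in> HL M k"
  shows "ext_d M k \<omega> \<in> L2_forms M (Suc k)" and "is_ext_deriv M \<omega> (ext_d M k \<omega>)"
proof -
  have "\<exists>\<eta>. \<eta> \<in> L2_forms M (Suc k) \<and> is_ext_deriv M \<omega> \<eta>"
    using assms unfolding HL_def by blast
  from someI_ex[OF this]
  show "ext_d M k \<omega> \<in> L2_forms M (Suc k)" and "is_ext_deriv M \<omega> (ext_d M k \<omega>)"
    unfolding ext_d_def by blast+
qed

lemma HL_lin:
  assumes \<alpha>: "\<alpha> \<in> HL M k" and \<beta>: "\<beta> \<in> HL M k"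
  shows "lin_form a \<alpha> b \<beta> \<in> HL M k"
  unfolding HL_def mem_Collect_eq
proof
  show "lin_form a \<alpha> b \<beta> \<in> L2_forms M k"
    by (intro L2_forms_lin HL_subset_L2 \<alpha> \<beta>)
  show "\<exists>\<eta>\<in>L2_forms M (Suc k). is_ext_deriv M (lin_form a \<alpha> b \<beta>) \<eta>"
  proof
    show "is_ext_deriv M (lin_form a \<alpha> b \<beta>) (lin_form a (ext_d M k \<alpha>) b (ext_d M k \<beta>))"
      by (intro is_ext_deriv_lin ext_d \<alpha> \<beta>)
    show "lin_form a (ext_d M k \<alpha>) b (ext_d M k \<beta>) \<in> L2_forms M (Suc k)"
      by (intro L2_forms_lin ext_d \<alpha> \<beta>)
  qed
qed

lemma form_eq_iff: "form_eq M \<alpha> \<beta> \<longleftrightarrow> form_eq M (lin_form 1 \<alpha> (-1) \<beta>) zero_form"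
  unfolding form_eq_def lin_form_apply by (simp add: zero_form_def fun_eq_iff)

text \<open>
  The operator \<open>ext_d\<close> chooses a representative of the derivative, so it is linear only up to null
  sets: the difference of the two sides is a weak derivative of a form that is zero.
\<close>

lemma ext_d_lin:
  assumes \<alpha>: "\<alpha> \<in> HL M k" and \<beta>: "\<beta> \<in> HL M k"
  shows "form_eq M (ext_d M k (lin_form a \<alpha> b \<beta>)) (lin_form a (ext_d M k \<alpha>) b (ext_d M k \<beta>))"
  unfolding form_eq_iff[of "ext_d M k (lin_form a \<alpha> b \<beta>)"]
proof (rule is_ext_deriv_null)
  show "is_ext_deriv M (lin_form 1 (lin_form a \<alpha> b \<beta>) (- 1) (lin_form a \<alpha> b \<beta>))
     (lin_form 1 (ext_d M k (lin_form a \<alpha> b \<beta>)) (- 1) (lin_form a (ext_d M k \<alpha>) b (ext_d M k \<beta>)))"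
    by (intro is_ext_deriv_lin ext_d HL_lin \<alpha> \<beta>)
  show "form_eq M (lin_form 1 (lin_form a \<alpha> b \<beta>) (- 1) (lin_form a \<alpha> b \<beta>)) zero_form"
    by (simp add: form_eq_def lin_form_def zero_form_def fun_eq_iff)
qed

lemma ext_d_null:
  assumes "\<alpha> \<in> HL M k" "form_eq M \<alpha> zero_form"
  shows "form_eq M (ext_d M k \<alpha>) zero_form"
  using is_ext_deriv_null[OF ext_d(2)[OF assms(1)] assms(2)] .

end

section \<open>Symmetric bilinear forms on finite-dimensional spaces\<close>

definition linear_on_subspace :: "'v::real_vector set \<Rightarrow> ('v \<Rightarrow> real) \<Rightarrow> bool" where
  "linear_on_subspace X F \<longleftrightarrow> (\<forall>x\<in>X. \<forall>y\<in>X. \<forall>a b. F (a *\<^sub>R x + b *\<^sub>R y) = a * F x + b * F y)"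

lemma linear_on_subspaceD:
  "linear_on_subspace X F \<Longrightarrow> x \<in> X \<Longrightarrow> y \<in> X \<Longrightarrow> F (a *\<^sub>R x + b *\<^sub>R y) = a * F x + b * F y"
  by (simp add: linear_on_subspace_def)

lemma subspace_lin: "subspace X \<Longrightarrow> x \<in> X \<Longrightarrow> y \<in> X \<Longrightarrow> a *\<^sub>R x + b *\<^sub>R y \<in> X"
  by (simp add: subspace_add subspace_scale)

lemma subspaceI_lin:
  fixes X :: "'v::real_vector set"
  assumes "0 \<in> X" "\<And>x y a b. x \<in> X \<Longrightarrow> y \<in> X \<Longrightarrow> a *\<^sub>R x + b *\<^sub>R y \<in> X"
  shows "subspace X"
  unfolding subspace_def using assms(1) assms(2)[of _ _ 1 1] assms(2)[of _ 0 _ 0] by simp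

lemma linear_on_subspace_0: "linear_on_subspace X F \<Longrightarrow> subspace X \<Longrightarrow> F 0 = 0"
  using linear_on_subspaceD[of X F 0 0 0 0] subspace_0[of X] by simp

lemma linear_on_subspace_sum:
  assumes F: "linear_on_subspace X F" and X: "subspace X" and B: "finite B" "B \<subseteq> X"
  shows "F (\<Sum>b\<in>B. c b *\<^sub>R b) = (\<Sum>b\<in>B. c b * F b)"
  using B
proof (induction B rule: finite_induct)
  case empty
  show ?case using linear_on_subspace_0[OF F X] by simp
next
  case (insert b B)
  have "(\<Sum>b\<in>B. c b *\<^sub>R b) \<in> X"
    using insert.prems by (intro subspace_sum[OF X] subspace_scale[OF X]) auto
  then show ?case
    using linear_on_subspaceD[OF F, of b "\<Sum>b\<in>B. c b *\<^sub>R b" "c b" 1] insert by simp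
qed

text \<open>
  A functional that vanishes on the common kernel of finitely many functionals is a combination of
  them.  In the induction step, either \<open>f j\<close> can be omitted, or some \<open>z\<close> is killed by all the
  other \<open>f i\<close> but not by \<open>f j\<close>; then a multiple of \<open>f j\<close> is subtracted from \<open>F\<close> to make it vanish
  at \<open>z\<close>.
\<close>

lemma linear_functional_in_span:
  assumes X: "subspace X" and F: "linear_on_subspace X F"
    and I: "finite I" "\<And>i. i \<in> I \<Longrightarrow> linear_on_subspace X (f i)"
    and vanish: "\<And>x. x \<in> X \<Longrightarrow> (\<And>i. i \<in> I \<Longrightarrow> f i x = 0) \<Longrightarrow> F x = 0"
  shows "\<exists>c. \<forall>x\<in>X. F x = (\<Sum>i\<in>I. c i * f i x)"
  using I F vanish
proof (induction I arbitrary: F rule: finite_induct)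
  case empty
  then show ?case by simp
next
  case (insert j I)
  have fI: "\<And>i. i \<in> I \<Longrightarrow> linear_on_subspace X (f i)" and fj: "linear_on_subspace X (f j)"
    using insert.prems(1) by auto
  show ?case
  proof (cases "\<forall>x\<in>X. (\<forall>i\<in>I. f i x = 0) \<longrightarrow> f j x = 0")
    case True
    then have "\<exists>c. \<forall>x\<in>X. F x = (\<Sum>i\<in>I. c i * f i x)"
      using insert.prems(2,3) by (intro insert.IH fI) auto
    then obtain c where "\<forall>x\<in>X. F x = (\<Sum>i\<in>I. c i * f i x)" by blast
    then show ?thesis
      using insert.hyps by (intro exI[of _ "c(j := 0)"]) (auto intro!: sum.cong)
  next
    case False
    then obtain z where z: "z \<in> X" "\<And>i. i \<in> I \<Longrightarrow> f i z = 0" "f j z \<noteq> 0" by blast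
    define F' where "F' x = F x - F z / f j z * f j x" for x
    have "linear_on_subspace X F'"
      using insert.prems(2) fj unfolding linear_on_subspace_def F'_def by (simp add: algebra_simps)
    moreover have "F' x = 0" if x: "x \<in> X" "\<And>i. i \<in> I \<Longrightarrow> f i x = 0" for x
    proof -
      \<comment> \<open>The correction of \<open>x\<close> by a multiple of \<open>z\<close> lies in the kernel of all functionals, including \<open>f j\<close>.\<close>
      let ?y = "1 *\<^sub>R x + (- (f j x / f j z)) *\<^sub>R z"
      have "?y \<in> X" using x(1) z(1) by (rule subspace_lin[OF X])
      moreover have "f i ?y = 0" if "i \<in> insert j I" for i
        using that linear_on_subspaceD[OF insert.prems(1)[OF that] x(1) z(1), of 1 "- (f j x / f j z)"] x(2) z(2,3)
        by auto
      ultimately have "F ?y = 0" using insert.prems(3) by blast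
      then show ?thesis
        using linear_on_subspaceD[OF insert.prems(2) x(1) z(1), of 1 "- (f j x / f j z)"]
        by (simp add: F'_def mult.commute)
    qed
    ultimately obtain c where c: "\<forall>x\<in>X. F' x = (\<Sum>i\<in>I. c i * f i x)"
      using insert.IH[OF fI, of F'] by blast
    have "F x = (\<Sum>i\<in>insert j I. (c(j := F z / f j z)) i * f i x)" if "x \<in> X" for x
    proof -
      have "(\<Sum>i\<in>I. (c(j := F z / f j z)) i * f i x) = (\<Sum>i\<in>I. c i * f i x)"
        using insert.hyps by (intro sum.cong) auto
      then show ?thesis using c that insert.hyps by (auto simp: F'_def algebra_simps)
    qed
    then show ?thesis by blast
  qed
qed

text \<open>
  Finite dimension of \<open>X / (X \<inter> N)\<close>.  The spaces of forms consist of functions and are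
  finite-dimensional only after null forms are factored out.
\<close>

definition finite_dim_modulo :: "'v::real_vector set \<Rightarrow> 'v set \<Rightarrow> bool" where
  "finite_dim_modulo N X \<longleftrightarrow> (\<exists>B. finite B \<and> B \<subseteq> X \<and> (\<forall>x\<in>X. \<exists>s\<in>span B. x - s \<in> N))"

text \<open>
  Induction on the spanning set.  The elements of \<open>W\<close> that need no multiple of \<open>b\<close> are covered by
  the induction hypothesis, and a single further element \<open>z\<close> suffices to remove the multiple of \<open>b\<close>
  from all others.
\<close>

lemma finite_dim_modulo_subspace_aux:
  assumes "finite B" "subspace N" "subspace W" "\<forall>w\<in>W. \<exists>s\<in>span B. w - s \<in> N"
  shows "finite_dim_modulo N W"
  using assms(1,3,4)
proof (induction B arbitrary: W rule: finite_induct)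
  case empty
  then show ?case unfolding finite_dim_modulo_def by (intro exI[of _ "{}"]) auto
next
  case (insert b B)
  note N = \<open>subspace N\<close> and W = \<open>subspace W\<close>
  define W0 where "W0 = {w \<in> W. \<exists>s\<in>span B. w - s \<in> N}"
  have "subspace W0"
    unfolding subspace_def
  proof (intro conjI ballI allI)
    show "0 \<in> W0" using subspace_0[OF W] subspace_0[OF N] span_zero[of B] by (force simp: W0_def)
  next
    fix x y assume "x \<in> W0" "y \<in> W0"
    then obtain s t where "x \<in> W" "y \<in> W" "s \<in> span B" "t \<in> span B" "x - s \<in> N" "y - t \<in> N"
      by (auto simp: W0_def)
    moreover from this have "(x + y) - (s + t) \<in> N"
      using subspace_add[OF N, of "x - s" "y - t"] by (simp add: algebra_simps)
    ultimately show "x + y \<in> W0" unfolding W0_def using subspace_add[OF W] span_add by blast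
  next
    fix c x assume "x \<in> W0"
    then obtain s where "x \<in> W" "s \<in> span B" "x - s \<in> N" by (auto simp: W0_def)
    moreover from this have "c *\<^sub>R x - c *\<^sub>R s \<in> N"
      using subspace_scale[OF N, of "x - s" c] by (simp add: algebra_simps)
    ultimately show "c *\<^sub>R x \<in> W0" unfolding W0_def using subspace_scale[OF W] span_scale by blast
  qed
  then have "finite_dim_modulo N W0"
    by (rule insert.IH) (simp add: W0_def)
  then obtain C where C: "finite C" "C \<subseteq> W0" "\<forall>x\<in>W0. \<exists>s\<in>span C. x - s \<in> N"
    unfolding finite_dim_modulo_def by blast
  have "W0 \<subseteq> W" by (auto simp: W0_def)
  show ?case
  proof (cases "W \<subseteq> W0")
    case True
    then show ?thesis using C \<open>W0 \<subseteq> W\<close> unfolding finite_dim_modulo_def by blast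
  next
    case False
    then obtain z where z: "z \<in> W" "z \<notin> W0" by blast
    obtain t where t: "t \<in> span (insert b B)" "z - t \<in> N" using insert.prems(2) z(1) by blast
    obtain m where m: "t - m *\<^sub>R b \<in> span B" using t(1) unfolding span_breakdown_eq by blast
    have "m \<noteq> 0" using m t(2) z unfolding W0_def by auto
    have "\<exists>s\<in>span (insert z C). w - s \<in> N" if w: "w \<in> W" for w
    proof -
      obtain s where s: "s \<in> span (insert b B)" "w - s \<in> N" using insert.prems(2) w by blast
      obtain l where l: "s - l *\<^sub>R b \<in> span B" using s(1) unfolding span_breakdown_eq by blast
      \<comment> \<open>Subtracting this multiple of \<open>z\<close> from \<open>w\<close> cancels the multiples of \<open>b\<close>.\<close>
      define r where "r = l / m"
      have "(w - s) - r *\<^sub>R (z - t) \<in> N"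
        by (rule subspace_diff[OF N s(2) subspace_scale[OF N t(2)]])
      moreover have "(s - l *\<^sub>R b) - r *\<^sub>R (t - m *\<^sub>R b) \<in> span B"
        by (rule span_diff[OF l span_scale[OF m]])
      moreover have "(s - l *\<^sub>R b) - r *\<^sub>R (t - m *\<^sub>R b) = s - r *\<^sub>R t"
        using \<open>m \<noteq> 0\<close> by (simp add: r_def algebra_simps)
      moreover have "(w - s) - r *\<^sub>R (z - t) = (w - r *\<^sub>R z) - (s - r *\<^sub>R t)"
        by (simp add: algebra_simps)
      moreover have "w - r *\<^sub>R z \<in> W"
        using w z(1) by (intro subspace_diff[OF W] subspace_scale[OF W])
      ultimately have "w - r *\<^sub>R z \<in> W0" unfolding W0_def by auto
      then obtain u where u: "u \<in> span C" "w - r *\<^sub>R z - u \<in> N" using C(3) by blast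
      have "u + r *\<^sub>R z \<in> span (insert z C)"
        using subsetD[OF span_mono[OF subset_insertI] u(1)]
        by (rule span_add) (rule span_scale[OF span_base[OF insertI1]])
      moreover have "w - (u + r *\<^sub>R z) \<in> N" using u(2) by (simp add: algebra_simps)
      ultimately show ?thesis by blast
    qed
    then show ?thesis
      using C \<open>W0 \<subseteq> W\<close> z(1) unfolding finite_dim_modulo_def by (intro exI[of _ "insert z C"]) auto
  qed
qed

lemma finite_dim_modulo_subspace:
  assumes "finite_dim_modulo N X" "subspace N" "subspace W" "W \<subseteq> X"
  shows "finite_dim_modulo N W"
proof -
  obtain B where "finite B" "\<forall>x\<in>X. \<exists>s\<in>span B. x - s \<in> N"
    using assms(1) unfolding finite_dim_modulo_def by blast
  then show ?thesis using assms by (intro finite_dim_modulo_subspace_aux[of B]) auto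
qed

lemma finite_dim_modulo_Times:
  assumes "finite_dim_modulo N X" "finite_dim_modulo N' X'" and "0 \<in> X" "0 \<in> X'"
  shows "finite_dim_modulo (N \<times> N') (X \<times> X')"
proof -
  obtain B B' where B: "finite B" "B \<subseteq> X" "\<forall>x\<in>X. \<exists>s\<in>span B. x - s \<in> N"
    and B': "finite B'" "B' \<subseteq> X'" "\<forall>x\<in>X'. \<exists>s\<in>span B'. x - s \<in> N'"
    using assms(1,2) unfolding finite_dim_modulo_def by blast
  let ?f = "\<lambda>x. (x, 0)" and ?g = "\<lambda>y. (0, y)"
  let ?C = "?f ` B \<union> ?g ` B'"
  have lf: "linear ?f" and lg: "linear ?g" by (auto intro!: linearI)
  have "\<exists>s\<in>span ?C. p - s \<in> N \<times> N'" if p: "p \<in> X \<times> X'" for p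
  proof -
    obtain x y where xy: "p = (x, y)" "x \<in> X" "y \<in> X'" using p by auto
    obtain s t where st: "s \<in> span B" "x - s \<in> N" "t \<in> span B'" "y - t \<in> N'" using B(3) B'(3) xy by blast
    have "?f s \<in> span ?C"
      using st(1) linear_span_image[OF lf, of B] span_mono[of "?f ` B" ?C] by blast
    moreover have "?g t \<in> span ?C"
      using st(3) linear_span_image[OF lg, of B'] span_mono[of "?g ` B'" ?C] by blast
    ultimately have "?f s + ?g t \<in> span ?C" by (rule span_add)
    then show ?thesis using st xy by (intro bexI[of _ "(s, t)"]) auto
  qed
  then show ?thesis
    unfolding finite_dim_modulo_def using B B' assms(3,4) by (intro exI[of _ ?C]) auto
qed

text \<open>
  By symmetry, the radical of \<open>A\<close> is the common kernel of the functionals \<open>A \<cdot> b\<close>, where \<open>b\<close> runs through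
  a spanning set.  As \<open>F\<close> vanishes there, it is a combination of finitely many of them.
\<close>

lemma symmetric_form_represents:
  fixes A :: "'v::real_vector \<Rightarrow> 'v \<Rightarrow> real"
  assumes X: "subspace X" and fin: "finite_dim_modulo N X"
    and lin: "\<And>y. y \<in> X \<Longrightarrow> linear_on_subspace X (\<lambda>x. A x y)"
    and sym: "\<And>x y. x \<in> X \<Longrightarrow> y \<in> X \<Longrightarrow> A x y = A y x"
    and null: "\<And>x y. x \<in> X \<Longrightarrow> x \<in> N \<Longrightarrow> y \<in> X \<Longrightarrow> A x y = 0"
    and F: "linear_on_subspace X F"
    and radical: "\<And>x. x \<in> X \<Longrightarrow> (\<And>y. y \<in> X \<Longrightarrow> A y x = 0) \<Longrightarrow> F x = 0"
  shows "\<exists>u\<in>X. \<forall>x\<in>X. A x u = F x"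
proof -
  obtain B where B: "finite B" "B \<subseteq> X" "\<forall>x\<in>X. \<exists>s\<in>span B. x - s \<in> N"
    using fin unfolding finite_dim_modulo_def by blast
  have span_B: "span B \<subseteq> X" using span_minimal[OF B(2) X] .
  have "\<exists>c. \<forall>x\<in>X. F x = (\<Sum>b\<in>B. c b * A x b)"
  proof (rule linear_functional_in_span[OF X F B(1)])
    show "linear_on_subspace X (\<lambda>x. A x b)" if "b \<in> B" for b
      using lin that B(2) by blast
    fix x assume x: "x \<in> X" and 0: "\<And>b. b \<in> B \<Longrightarrow> A x b = 0"
    show "F x = 0"
    proof (rule radical[OF x])
      fix y assume y: "y \<in> X"
      obtain s where s: "s \<in> span B" "y - s \<in> N" using B(3) y by blast
      have "s \<in> X" using s(1) span_B by blast
      have "A s x = 0"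
      proof -
        obtain T c where "finite T" "T \<subseteq> B" and T: "s = (\<Sum>b\<in>T. c b *\<^sub>R b)"
          using s(1) unfolding span_explicit by blast
        moreover from this have "A s x = (\<Sum>b\<in>T. c b * A b x)"
          using B(2) linear_on_subspace_sum[OF lin[OF x] X, of T c] by auto
        moreover have "A b x = 0" if "b \<in> T" for b
        proof -
          have "b \<in> B" "b \<in> X" using that \<open>T \<subseteq> B\<close> B(2) by blast+
          then show ?thesis using 0[of b] sym[OF x, of b] by simp
        qed
        ultimately show ?thesis by simp
      qed
      moreover have "A (y - s) x = 0"
        using null[of "y - s" x] s(2) y x \<open>s \<in> X\<close> subspace_diff[OF X] by blast
      moreover have "y = 1 *\<^sub>R s + 1 *\<^sub>R (y - s)" by simp
      ultimately show "A y x = 0"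
        using linear_on_subspaceD[OF lin[OF x] \<open>s \<in> X\<close> subspace_diff[OF X y \<open>s \<in> X\<close>], of 1 1] by simp
    qed
  qed
  then obtain c where c: "\<And>x. x \<in> X \<Longrightarrow> F x = (\<Sum>b\<in>B. c b * A x b)" by blast
  let ?u = "\<Sum>b\<in>B. c b *\<^sub>R b"
  have u: "?u \<in> X" using B(2) by (intro subspace_sum[OF X] subspace_scale[OF X]) auto
  moreover have "A x ?u = F x" if x: "x \<in> X" for x
  proof -
    have "A x ?u = A ?u x" using x u by (rule sym)
    also have "\<dots> = (\<Sum>b\<in>B. c b * A b x)" by (rule linear_on_subspace_sum[OF lin[OF x] X B(1,2)])
    also have "\<dots> = F x" unfolding c[OF x] using B(2) sym[OF x] by (intro sum.cong) auto
    finally show ?thesis .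
  qed
  ultimately show ?thesis by blast
qed

section \<open>Forms as a vector space\<close>

instantiation "fun" :: (type, real_vector) real_vector
begin
definition scaleR_fun :: "real \<Rightarrow> ('a \<Rightarrow> 'b) \<Rightarrow> 'a \<Rightarrow> 'b" where
  "scaleR_fun c f = (\<lambda>x. c *\<^sub>R f x)"
instance
  by standard (simp_all add: scaleR_fun_def fun_eq_iff algebra_simps)
end

lemma lin_form_eq: "lin_form a \<alpha> b \<beta> = a *\<^sub>R \<alpha> + b *\<^sub>R \<beta>"
  by (simp add: lin_form_def scaleR_fun_def fun_eq_iff)

lemma zero_form_eq: "zero_form = 0"
  by (simp add: zero_form_def fun_eq_iff)

lemma sum_scaleR_form_apply:
  fixes c :: "'n::finite form \<Rightarrow> real"
  shows "(\<Sum>\<beta>\<in>B. c \<beta> *\<^sub>R \<beta>) = (\<lambda>i x I. \<Sum>\<beta>\<in>B. c \<beta> * \<beta> i x I)"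
  by (induction B rule: infinite_finite_induct) (simp_all add: scaleR_fun_def fun_eq_iff)

context riemannian_manifold
begin

text \<open>
  Equality of classes of forms is equality modulo this subspace, which makes notions of linear
  algebra applicable.
\<close>

definition null_forms :: "'n form set" where
  "null_forms = {\<omega>. form_eq M \<omega> 0}"

lemma form_eq_iff_null: "form_eq M \<alpha> \<beta> \<longleftrightarrow> \<alpha> - \<beta> \<in> null_forms"
  using form_eq_iff[of \<alpha> \<beta>] by (simp add: null_forms_def lin_form_eq zero_form_eq)

lemma subspace_null_forms: "subspace null_forms"
  unfolding subspace_def
proof (intro conjI ballI allI)
  show "0 \<in> null_forms" by (simp add: null_forms_def form_eq_def)
next
  fix \<alpha> \<beta> assume "\<alpha> \<in> null_forms" "\<beta> \<in> null_forms"
  then have 0: "AE x in lebesgue. x \<in> img_of M i \<longrightarrow> \<alpha> i x = 0" "AE x in lebesgue. x \<in> img_of M i \<longrightarrow> \<beta> i x = 0" for i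
    by (auto simp: null_forms_def form_eq_def)
  have "AE x in lebesgue. x \<in> img_of M i \<longrightarrow> (\<alpha> + \<beta>) i x = 0" for i
    using 0[of i] by eventually_elim simp
  then show "\<alpha> + \<beta> \<in> null_forms" by (simp add: null_forms_def form_eq_def)
next
  fix c \<alpha> assume "\<alpha> \<in> null_forms"
  then have "AE x in lebesgue. x \<in> img_of M i \<longrightarrow> \<alpha> i x = 0" for i
    by (auto simp: null_forms_def form_eq_def)
  then have "AE x in lebesgue. x \<in> img_of M i \<longrightarrow> (c *\<^sub>R \<alpha>) i x = 0" for i
    by (rule AE_mp) (auto intro!: AE_I2 simp: scaleR_fun_def fun_eq_iff)
  then show "c *\<^sub>R \<alpha> \<in> null_forms" by (simp add: null_forms_def form_eq_def)
qed

lemma l2_lin: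
  "\<alpha> \<in> L2_forms M k \<Longrightarrow> \<beta> \<in> L2_forms M k \<Longrightarrow> \<gamma> \<in> L2_forms M k \<Longrightarrow>
    l2_inner M (a *\<^sub>R \<alpha> + b *\<^sub>R \<beta>) \<gamma> = a * l2_inner M \<alpha> \<gamma> + b * l2_inner M \<beta> \<gamma>"
  using l2_inner_lin_left[of \<alpha> k \<beta> \<gamma> a b] by (simp add: lin_form_eq)

lemma l2_lin_right:
  "\<alpha> \<in> L2_forms M k \<Longrightarrow> \<beta> \<in> L2_forms M k \<Longrightarrow> \<gamma> \<in> L2_forms M k \<Longrightarrow>
    l2_inner M \<gamma> (a *\<^sub>R \<alpha> + b *\<^sub>R \<beta>) = a * l2_inner M \<gamma> \<alpha> + b * l2_inner M \<gamma> \<beta>"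
  using l2_lin[of \<alpha> k \<beta> \<gamma> a b] by (simp only: l2_inner_commute[of \<gamma>])

lemma l2_null: "\<alpha> \<in> null_forms \<Longrightarrow> l2_inner M \<alpha> \<beta> = 0"
  using l2_inner_null[of \<alpha> \<beta>] by (simp add: null_forms_def zero_form_eq)

lemma l2_null_right: "\<alpha> \<in> null_forms \<Longrightarrow> l2_inner M \<beta> \<alpha> = 0"
  using l2_null[of \<alpha> \<beta>] by (simp only: l2_inner_commute[of \<beta>])

lemma l2_eq_0_imp_null: "\<alpha> \<in> L2_forms M k \<Longrightarrow> l2_inner M \<alpha> \<alpha> = 0 \<Longrightarrow> \<alpha> \<in> null_forms"
  using l2_inner_eq_0_imp[of \<alpha> k] by (simp add: null_forms_def zero_form_eq)

lemma HL_linear: "\<alpha> \<in> HL M k \<Longrightarrow> \<beta> \<in> HL M k \<Longrightarrow> a *\<^sub>R \<alpha> + b *\<^sub>R \<beta> \<in> HL M k"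
  using HL_lin[of \<alpha> k \<beta> a b] by (simp add: lin_form_eq)

lemma ext_d_linear:
  "\<alpha> \<in> HL M k \<Longrightarrow> \<beta> \<in> HL M k \<Longrightarrow>
    ext_d M k (a *\<^sub>R \<alpha> + b *\<^sub>R \<beta>) - (a *\<^sub>R ext_d M k \<alpha> + b *\<^sub>R ext_d M k \<beta>) \<in> null_forms"
  using ext_d_lin[of \<alpha> k \<beta> a b] by (simp only: lin_form_eq form_eq_iff_null)

lemma ext_d_null_forms: "\<alpha> \<in> HL M k \<Longrightarrow> \<alpha> \<in> null_forms \<Longrightarrow> ext_d M k \<alpha> \<in> null_forms"
  using ext_d_null[of \<alpha> k] by (simp add: null_forms_def zero_form_eq)

lemma l2_ext_d_lin:
  assumes \<alpha>: "\<alpha> \<in> HL M k" and \<beta>: "\<beta> \<in> HL M k" and \<gamma>: "\<gamma> \<in> L2_forms M (Suc k)"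
  shows "l2_inner M (ext_d M k (a *\<^sub>R \<alpha> + b *\<^sub>R \<beta>)) \<gamma> =
    a * l2_inner M (ext_d M k \<alpha>) \<gamma> + b * l2_inner M (ext_d M k \<beta>) \<gamma>"
proof -
  let ?x = "ext_d M k (a *\<^sub>R \<alpha> + b *\<^sub>R \<beta>)" and ?y = "a *\<^sub>R ext_d M k \<alpha> + b *\<^sub>R ext_d M k \<beta>"
  have y: "?y \<in> L2_forms M (Suc k)"
    using L2_forms_lin[OF ext_d(1)[OF \<alpha>] ext_d(1)[OF \<beta>], of a b] by (simp add: lin_form_eq)
  have "l2_inner M (1 *\<^sub>R ?x + (- 1) *\<^sub>R ?y) \<gamma> = 1 * l2_inner M ?x \<gamma> + (- 1) * l2_inner M ?y \<gamma>"
    by (rule l2_lin[OF ext_d(1)[OF HL_linear[OF \<alpha> \<beta>]] y \<gamma>])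
  moreover have "1 *\<^sub>R ?x + (- 1) *\<^sub>R ?y = ?x - ?y" by simp
  then have "l2_inner M (1 *\<^sub>R ?x + (- 1) *\<^sub>R ?y) \<gamma> = 0"
    by (simp only: l2_null[OF ext_d_linear[OF \<alpha> \<beta>]])
  ultimately show ?thesis
    using l2_lin[OF ext_d(1)[OF \<alpha>] ext_d(1)[OF \<beta>] \<gamma>, of a b] by simp
qed

lemma l2_ext_d_lin_right:
  assumes "\<alpha> \<in> HL M k" and "\<beta> \<in> HL M k" and "\<gamma> \<in> L2_forms M (Suc k)"
  shows "l2_inner M \<gamma> (ext_d M k (a *\<^sub>R \<alpha> + b *\<^sub>R \<beta>)) =
    a * l2_inner M \<gamma> (ext_d M k \<alpha>) + b * l2_inner M \<gamma> (ext_d M k \<beta>)"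
  using l2_ext_d_lin[OF assms, of a b] by (simp only: l2_inner_commute[of \<gamma>])

end

section \<open>Finite-dimensional subcomplexes and the mixed system\<close>

locale discrete_complex = riemannian_manifold M
  for M :: "('m, 'n::{finite,linorder}) manifold_data" +
  fixes V :: "nat \<Rightarrow> 'n form set"
  assumes subcomplex: "findim_subcomplex M V"
begin

lemma V_findim_subspace: "findim_subspace M k (V k)"
  using subcomplex unfolding findim_subcomplex_def by blast

lemma V_HL: "\<alpha> \<in> V k \<Longrightarrow> \<alpha> \<in> HL M k"
  using V_findim_subspace[of k] unfolding findim_subspace_def by blast

lemma V_L2: "\<alpha> \<in> V k \<Longrightarrow> \<alpha> \<in> L2_forms M k"
  by (intro HL_subset_L2 V_HL)

lemma ext_d_V: "\<alpha> \<in> V k \<Longrightarrow> ext_d M k \<alpha> \<in> V (Suc k)"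
  using subcomplex unfolding findim_subcomplex_def by blast

lemma ext_d_V_L2: "\<alpha> \<in> V k \<Longrightarrow> ext_d M k \<alpha> \<in> L2_forms M (Suc k)"
  by (intro V_L2 ext_d_V)

lemma V_linear: "\<alpha> \<in> V k \<Longrightarrow> \<beta> \<in> V k \<Longrightarrow> a *\<^sub>R \<alpha> + b *\<^sub>R \<beta> \<in> V k"
  using V_findim_subspace[of k] unfolding findim_subspace_def lin_form_eq by blast

lemma zero_in_V: "0 \<in> V k"
  using V_findim_subspace[of k] unfolding findim_subspace_def zero_form_eq by blast

lemma subspace_V: "subspace (V k)"
  by (intro subspaceI_lin zero_in_V V_linear)

lemma ext_d_0: "ext_d M k 0 \<in> null_forms"
  by (intro ext_d_null_forms V_HL zero_in_V subspace_0[OF subspace_null_forms])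

lemma finite_dim_V: "finite_dim_modulo null_forms (V k)"
proof -
  obtain B where B: "finite B" "B \<subseteq> V k"
    "\<forall>\<omega>\<in>V k. \<exists>c. form_eq M \<omega> (\<lambda>i x I. \<Sum>\<beta>\<in>B. c \<beta> * \<beta> i x I)"
    using V_findim_subspace[of k] unfolding findim_subspace_def by blast
  have "\<exists>s\<in>span B. \<omega> - s \<in> null_forms" if \<omega>: "\<omega> \<in> V k" for \<omega>
  proof -
    obtain c where "form_eq M \<omega> (\<lambda>i x I. \<Sum>\<beta>\<in>B. c \<beta> * \<beta> i x I)"
      using bspec[OF B(3) \<omega>] by (rule exE)
    then have "form_eq M \<omega> (\<Sum>\<beta>\<in>B. c \<beta> *\<^sub>R \<beta>)"
      by (simp only: sum_scaleR_form_apply)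
    moreover have "(\<Sum>\<beta>\<in>B. c \<beta> *\<^sub>R \<beta>) \<in> span B"
      by (intro span_sum span_scale span_base)
    ultimately show ?thesis unfolding form_eq_iff_null by blast
  qed
  then show ?thesis using B(1,2) unfolding finite_dim_modulo_def by blast
qed

abbreviation H :: "nat \<Rightarrow> 'n form set" where
  "H k \<equiv> discrete_harmonic M V (Suc k)"

lemma harmonic_iff:
  "\<omega> \<in> H k \<longleftrightarrow> \<omega> \<in> V (Suc k) \<and> ext_d M (Suc k) \<omega> \<in> null_forms \<and>
     (\<forall>\<eta>\<in>V k. l2_inner M (ext_d M k \<eta>) \<omega> = 0)"
  by (auto simp: discrete_harmonic_def discrete_cycles_def discrete_range_def null_forms_def zero_form_eq)

lemma H_V: "\<omega> \<in> H k \<Longrightarrow> \<omega> \<in> V (Suc k)"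
  by (simp add: harmonic_iff)

lemma subspace_H: "subspace (H k)"
proof (rule subspaceI_lin)
  show "0 \<in> H k"
    unfolding harmonic_iff using zero_in_V ext_d_0 l2_null_right subspace_0[OF subspace_null_forms] by blast
  fix \<alpha> \<beta> a b assume \<alpha>: "\<alpha> \<in> H k" and \<beta>: "\<beta> \<in> H k"
  let ?l = "a *\<^sub>R \<alpha> + b *\<^sub>R \<beta>"
  have "ext_d M (Suc k) ?l - (a *\<^sub>R ext_d M (Suc k) \<alpha> + b *\<^sub>R ext_d M (Suc k) \<beta>) \<in> null_forms"
    by (intro ext_d_linear V_HL H_V \<alpha> \<beta>)
  moreover have "a *\<^sub>R ext_d M (Suc k) \<alpha> + b *\<^sub>R ext_d M (Suc k) \<beta> \<in> null_forms"
    using \<alpha> \<beta> by (intro subspace_lin subspace_null_forms) (simp_all add: harmonic_iff)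
  ultimately have "ext_d M (Suc k) ?l \<in> null_forms"
    using subspace_add[OF subspace_null_forms] by fastforce
  moreover have "l2_inner M (ext_d M k \<eta>) ?l = 0" if "\<eta> \<in> V k" for \<eta>
    using l2_lin_right[OF V_L2[OF H_V[OF \<alpha>]] V_L2[OF H_V[OF \<beta>]] ext_d_V_L2[OF that]] \<alpha> \<beta> that
    by (simp add: harmonic_iff)
  ultimately show "?l \<in> H k"
    using V_linear[OF H_V[OF \<alpha>] H_V[OF \<beta>]] by (simp add: harmonic_iff)
qed

lemma mixed_solution_iff:
  "mixed_solution M V k \<phi> l0 l1 l2 h \<longleftrightarrow>
     l0 \<in> V k \<and> l1 \<in> V (Suc k) \<and> l2 \<in> V (Suc (Suc k)) \<and> h \<in> H k \<and>
     (\<forall>\<eta>\<in>V k. l2_inner M \<eta> l0 + l2_inner M (ext_d M k \<eta>) l1 = l2_inner M \<eta> \<phi>) \<and>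
     (\<forall>\<eta>\<in>V (Suc k). l2_inner M \<eta> (ext_d M k l0) + l2_inner M (ext_d M (Suc k) \<eta>) l2
                    + l2_inner M \<eta> h = l2_inner M \<eta> (ext_d M k \<phi>)) \<and>
     (\<forall>\<eta>\<in>V (Suc (Suc k)). l2_inner M \<eta> (ext_d M (Suc k) l1) = 0) \<and>
     (\<forall>\<gamma>\<in>H k. l2_inner M \<gamma> l1 = 0)"
  by (simp add: mixed_solution_def)

text \<open>
  Testing the equations with \<open>l0\<close>, \<open>l1\<close>, \<open>l2\<close> and \<open>h\<close>, all coupling terms cancel and
  \<open>(l0, l0) = 0\<close> remains.  Testing the third one with \<open>d l1\<close> then shows that \<open>l1\<close> is harmonic, so
  the fourth one may be tested with \<open>l1\<close> itself.
\<close>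

lemma homogeneous_solution_null:
  assumes sol: "mixed_solution M V k \<phi> l0 l1 l2 h" and \<phi>: "\<phi> \<in> null_forms" "ext_d M k \<phi> \<in> null_forms"
  shows "l0 \<in> null_forms" and "l1 \<in> null_forms"
proof -
  note s = sol[unfolded mixed_solution_iff]
  have mem: "l0 \<in> V k" "l1 \<in> V (Suc k)" "l2 \<in> V (Suc (Suc k))" "h \<in> H k" using s by blast+
  have e1: "l2_inner M \<eta> l0 + l2_inner M (ext_d M k \<eta>) l1 = 0" if "\<eta> \<in> V k" for \<eta>
    using s that l2_null_right[OF \<phi>(1)] by simp
  have e2: "l2_inner M \<eta> (ext_d M k l0) + l2_inner M (ext_d M (Suc k) \<eta>) l2 + l2_inner M \<eta> h = 0"
    if "\<eta> \<in> V (Suc k)" for \<eta>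
    using s that l2_null_right[OF \<phi>(2)] by simp
  have e3: "l2_inner M \<eta> (ext_d M (Suc k) l1) = 0" if "\<eta> \<in> V (Suc (Suc k))" for \<eta>
    using s that by simp
  have e4: "l2_inner M \<gamma> l1 = 0" if "\<gamma> \<in> H k" for \<gamma>
    using s that by simp
  have "l2_inner M (ext_d M k l0) l1 = 0"
    using e2[OF mem(2)] e3[OF mem(3)] e4[OF mem(4)]
    by (simp add: l2_inner_commute[of l1] l2_inner_commute[of "ext_d M (Suc k) l1"])
  then have "l2_inner M l0 l0 = 0" using e1[OF mem(1)] by simp
  then show l0: "l0 \<in> null_forms" by (rule l2_eq_0_imp_null[OF V_L2[OF mem(1)]])
  have "l2_inner M (ext_d M k \<eta>) l1 = 0" if "\<eta> \<in> V k" for \<eta>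
    using e1[OF that] l2_null_right[OF l0] by simp
  moreover have "ext_d M (Suc k) l1 \<in> null_forms"
    by (rule l2_eq_0_imp_null[OF ext_d_V_L2[OF mem(2)] e3[OF ext_d_V[OF mem(2)]]])
  ultimately have "l1 \<in> H k" using mem(2) by (simp add: harmonic_iff)
  then show "l1 \<in> null_forms"
    by (intro l2_eq_0_imp_null[OF V_L2[OF mem(2)]] e4)
qed

text \<open>
  The sum of the left-hand sides of the four equations, with the test functions as first argument.
\<close>

definition mixed_form :: "nat \<Rightarrow> 'n form \<times> 'n form \<times> 'n form \<times> 'n form \<Rightarrow>
    'n form \<times> 'n form \<times> 'n form \<times> 'n form \<Rightarrow> real" where
  "mixed_form k = (\<lambda>(\<eta>0, \<eta>1, \<eta>2, \<gamma>) (l0, l1, l2, h).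
     (l2_inner M \<eta>0 l0 + l2_inner M (ext_d M k \<eta>0) l1) +
     (l2_inner M \<eta>1 (ext_d M k l0) + l2_inner M (ext_d M (Suc k) \<eta>1) l2 + l2_inner M \<eta>1 h) +
     l2_inner M \<eta>2 (ext_d M (Suc k) l1) + l2_inner M \<gamma> l1)"

definition mixed_space :: "nat \<Rightarrow> ('n form \<times> 'n form \<times> 'n form \<times> 'n form) set" where
  "mixed_space k = V k \<times> V (Suc k) \<times> V (Suc (Suc k)) \<times> H k"

definition mixed_rhs :: "nat \<Rightarrow> 'n form \<Rightarrow> 'n form \<times> 'n form \<times> 'n form \<times> 'n form \<Rightarrow> real" where
  "mixed_rhs k \<phi> p = l2_inner M (fst p) \<phi> + l2_inner M (fst (snd p)) (ext_d M k \<phi>)"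

text \<open>
  The single equation for the sum is equivalent to the four equations because all but one of the
  test functions may be chosen to be zero.
\<close>

lemma mixed_solution_iff_form:
  "mixed_solution M V k \<phi> l0 l1 l2 h \<longleftrightarrow> (l0, l1, l2, h) \<in> mixed_space k \<and>
    (\<forall>p\<in>mixed_space k. mixed_form k p (l0, l1, l2, h) = mixed_rhs k \<phi> p)"
proof
  assume s: "mixed_solution M V k \<phi> l0 l1 l2 h"
  have "mixed_form k p (l0, l1, l2, h) = mixed_rhs k \<phi> p" if "p \<in> mixed_space k" for p
  proof -
    obtain \<eta>0 \<eta>1 \<eta>2 \<gamma> where p: "p = (\<eta>0, \<eta>1, \<eta>2, \<gamma>)" by (cases p)
    then have "\<eta>0 \<in> V k" "\<eta>1 \<in> V (Suc k)" "\<eta>2 \<in> V (Suc (Suc k))" "\<gamma> \<in> H k"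
      using that by (auto simp: mixed_space_def)
    then have "l2_inner M \<eta>0 l0 + l2_inner M (ext_d M k \<eta>0) l1 = l2_inner M \<eta>0 \<phi>"
      "l2_inner M \<eta>1 (ext_d M k l0) + l2_inner M (ext_d M (Suc k) \<eta>1) l2 + l2_inner M \<eta>1 h =
         l2_inner M \<eta>1 (ext_d M k \<phi>)"
      "l2_inner M \<eta>2 (ext_d M (Suc k) l1) = 0" "l2_inner M \<gamma> l1 = 0"
      using s unfolding mixed_solution_iff by blast+
    then show ?thesis by (simp only: p mixed_form_def mixed_rhs_def case_prod_conv fst_conv snd_conv add_0_right)
  qed
  moreover have "(l0, l1, l2, h) \<in> mixed_space k"
    using s unfolding mixed_solution_iff mixed_space_def by blast
  ultimately show "(l0, l1, l2, h) \<in> mixed_space k \<and>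
    (\<forall>p\<in>mixed_space k. mixed_form k p (l0, l1, l2, h) = mixed_rhs k \<phi> p)" by blast
next
  assume R: "(l0, l1, l2, h) \<in> mixed_space k \<and>
    (\<forall>p\<in>mixed_space k. mixed_form k p (l0, l1, l2, h) = mixed_rhs k \<phi> p)"
  then have mem: "l0 \<in> V k" "l1 \<in> V (Suc k)" "l2 \<in> V (Suc (Suc k))" "h \<in> H k"
    by (auto simp: mixed_space_def)
  have eq: "mixed_form k (\<eta>0, \<eta>1, \<eta>2, \<gamma>) (l0, l1, l2, h) =
       l2_inner M \<eta>0 \<phi> + l2_inner M \<eta>1 (ext_d M k \<phi>)"
    if "\<eta>0 \<in> V k" "\<eta>1 \<in> V (Suc k)" "\<eta>2 \<in> V (Suc (Suc k))" "\<gamma> \<in> H k" for \<eta>0 \<eta>1 \<eta>2 \<gamma>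
  proof -
    have "(\<eta>0, \<eta>1, \<eta>2, \<gamma>) \<in> mixed_space k" using that by (simp add: mixed_space_def)
    then show ?thesis using R by (auto simp: mixed_rhs_def)
  qed
  have z: "l2_inner M 0 \<omega> = 0" "l2_inner M (ext_d M j 0) \<omega> = 0" for j \<omega>
    using l2_null[OF subspace_0[OF subspace_null_forms]] l2_null[OF ext_d_0] by blast+
  note Z = zero_in_V subspace_0[OF subspace_H]
  show "mixed_solution M V k \<phi> l0 l1 l2 h"
    unfolding mixed_solution_iff
  proof (intro conjI mem ballI)
    fix \<eta> assume "\<eta> \<in> V k"
    from eq[OF this Z(1) Z(1) Z(2)]
    show "l2_inner M \<eta> l0 + l2_inner M (ext_d M k \<eta>) l1 = l2_inner M \<eta> \<phi>"
      by (simp add: mixed_form_def z)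
  next
    fix \<eta> assume "\<eta> \<in> V (Suc k)"
    from eq[OF Z(1) this Z(1) Z(2)]
    show "l2_inner M \<eta> (ext_d M k l0) + l2_inner M (ext_d M (Suc k) \<eta>) l2 + l2_inner M \<eta> h =
        l2_inner M \<eta> (ext_d M k \<phi>)"
      by (simp add: mixed_form_def z)
  next
    fix \<eta> assume "\<eta> \<in> V (Suc (Suc k))"
    from eq[OF Z(1) Z(1) this Z(2)]
    show "l2_inner M \<eta> (ext_d M (Suc k) l1) = 0"
      by (simp add: mixed_form_def z)
  next
    fix \<gamma> assume "\<gamma> \<in> H k"
    from eq[OF Z(1) Z(1) Z(1) this]
    show "l2_inner M \<gamma> l1 = 0"
      by (simp add: mixed_form_def z)
  qed
qed

text \<open>
  The saddle point structure: each coupling term occurs together with its mirror image.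
\<close>

lemma mixed_form_commute: "mixed_form k p q = mixed_form k q p"
  by (cases p, cases q) (simp add: mixed_form_def l2_inner_commute)

lemma mixed_form_lin:
  assumes q: "q \<in> mixed_space k"
  shows "linear_on_subspace (mixed_space k) (\<lambda>p. mixed_form k p q)"
  unfolding linear_on_subspace_def
proof (intro ballI allI)
  fix p p' a b assume p: "p \<in> mixed_space k" and p': "p' \<in> mixed_space k"
  obtain x0 x1 x2 g where px: "p = (x0, x1, x2, g)" by (cases p)
  obtain y0 y1 y2 g' where py: "p' = (y0, y1, y2, g')" by (cases p')
  obtain l0 l1 l2 h where ql: "q = (l0, l1, l2, h)" by (cases q)
  have x: "x0 \<in> V k" "x1 \<in> V (Suc k)" "x2 \<in> V (Suc (Suc k))" "g \<in> H k"
    using p px by (auto simp: mixed_space_def)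
  have y: "y0 \<in> V k" "y1 \<in> V (Suc k)" "y2 \<in> V (Suc (Suc k))" "g' \<in> H k"
    using p' py by (auto simp: mixed_space_def)
  have l: "l0 \<in> V k" "l1 \<in> V (Suc k)" "l2 \<in> V (Suc (Suc k))" "h \<in> H k"
    using q ql by (auto simp: mixed_space_def)
  have dl: "ext_d M k l0 \<in> V (Suc k)" "ext_d M (Suc k) l1 \<in> V (Suc (Suc k))"
    using l ext_d_V by blast+
  show "mixed_form k (a *\<^sub>R p + b *\<^sub>R p') q = a * mixed_form k p q + b * mixed_form k p' q"
    unfolding px py ql mixed_form_def scaleR_Pair add_Pair case_prod_conv
    by (simp only: l2_lin[OF x(1)[THEN V_L2] y(1)[THEN V_L2] l(1)[THEN V_L2]]
        l2_lin[OF x(2)[THEN V_L2] y(2)[THEN V_L2] dl(1)[THEN V_L2]]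
        l2_lin[OF x(2)[THEN V_L2] y(2)[THEN V_L2] l(4)[THEN H_V, THEN V_L2]]
        l2_lin[OF x(3)[THEN V_L2] y(3)[THEN V_L2] dl(2)[THEN V_L2]]
        l2_lin[OF x(4)[THEN H_V, THEN V_L2] y(4)[THEN H_V, THEN V_L2] l(2)[THEN V_L2]]
        l2_ext_d_lin[OF x(1)[THEN V_HL] y(1)[THEN V_HL] l(2)[THEN V_L2]]
        l2_ext_d_lin[OF x(2)[THEN V_HL] y(2)[THEN V_HL] l(3)[THEN V_L2]])
      (simp add: algebra_simps)
qed

lemma subspace_mixed_space: "subspace (mixed_space k)"
  unfolding mixed_space_def by (intro subspace_Times subspace_V subspace_H)

text \<open>
  An element of the radical solves the system with datum zero.  Its first two components are null, and
  the right-hand side only depends on these.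
\<close>

lemma mixed_solution_exists:
  assumes \<phi>: "\<phi> \<in> HL M k"
  shows "\<exists>l0 l1 l2 h. mixed_solution M V k \<phi> l0 l1 l2 h"
proof -
  let ?N = "null_forms \<times> null_forms \<times> null_forms \<times> null_forms"
  let ?F = "mixed_rhs k \<phi>"
  have d\<phi>: "ext_d M k \<phi> \<in> L2_forms M (Suc k)" by (rule ext_d(1)[OF \<phi>])
  have "\<exists>u\<in>mixed_space k. \<forall>x\<in>mixed_space k. mixed_form k x u = ?F x"
  proof (rule symmetric_form_represents)
    show "subspace (mixed_space k)" by (rule subspace_mixed_space)
    have "H k \<subseteq> V (Suc k)" using H_V by blast
    then have "finite_dim_modulo null_forms (H k)"
      by (rule finite_dim_modulo_subspace[OF finite_dim_V subspace_null_forms subspace_H])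
    then show "finite_dim_modulo ?N (mixed_space k)"
      unfolding mixed_space_def
      by (intro finite_dim_modulo_Times finite_dim_V subspace_0 subspace_Times subspace_V subspace_H)
    show "linear_on_subspace (mixed_space k) (\<lambda>x. mixed_form k x y)" if "y \<in> mixed_space k" for y
      using that by (rule mixed_form_lin)
    show "mixed_form k x y = mixed_form k y x" for x y by (rule mixed_form_commute)
    show "mixed_form k x y = 0" if "x \<in> mixed_space k" "x \<in> ?N" for x y
    proof -
      obtain x0 x1 x2 g where x: "x = (x0, x1, x2, g)" by (cases x)
      have "x0 \<in> null_forms" "x1 \<in> null_forms" "x2 \<in> null_forms" "g \<in> null_forms"
        "x0 \<in> V k" "x1 \<in> V (Suc k)"
        using that x by (auto simp: mixed_space_def)
      moreover from this have "ext_d M k x0 \<in> null_forms" "ext_d M (Suc k) x1 \<in> null_forms"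
        using ext_d_null_forms V_HL by blast+
      ultimately show ?thesis by (cases y) (simp add: x mixed_form_def l2_null)
    qed
    show "linear_on_subspace (mixed_space k) ?F"
      unfolding linear_on_subspace_def
    proof (intro ballI allI)
      fix p p' a b assume p: "p \<in> mixed_space k" and p': "p' \<in> mixed_space k"
      obtain x0 x1 x2 g where px: "p = (x0, x1, x2, g)" by (cases p)
      obtain y0 y1 y2 g' where py: "p' = (y0, y1, y2, g')" by (cases p')
      have x: "x0 \<in> L2_forms M k" "x1 \<in> L2_forms M (Suc k)"
        and y: "y0 \<in> L2_forms M k" "y1 \<in> L2_forms M (Suc k)"
        using p px p' py V_L2 by (auto simp: mixed_space_def)
      show "?F (a *\<^sub>R p + b *\<^sub>R p') = a * ?F p + b * ?F p'"
        unfolding px py scaleR_Pair add_Pair mixed_rhs_def fst_conv snd_conv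
        by (simp only: l2_lin[OF x(1) y(1) HL_subset_L2[OF \<phi>]] l2_lin[OF x(2) y(2) d\<phi>])
          (simp add: algebra_simps)
    qed
    show "?F x = 0" if x: "x \<in> mixed_space k" and 0: "\<And>y. y \<in> mixed_space k \<Longrightarrow> mixed_form k y x = 0" for x
    proof -
      obtain l0 l1 l2 h where xl: "x = (l0, l1, l2, h)" by (cases x)
      have z: "l2_inner M \<eta> 0 = 0" "l2_inner M \<eta> (ext_d M k 0) = 0" for \<eta>
        using l2_null_right[OF subspace_0[OF subspace_null_forms]] l2_null_right[OF ext_d_0] by blast+
      have "mixed_solution M V k 0 l0 l1 l2 h"
        unfolding mixed_solution_iff_form using x 0 by (simp add: xl mixed_rhs_def z)
      then have "l0 \<in> null_forms" "l1 \<in> null_forms"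
        using homogeneous_solution_null subspace_0[OF subspace_null_forms] ext_d_0 by blast+
      then show ?thesis by (simp add: xl mixed_rhs_def l2_null)
    qed
  qed
  then obtain u where "u \<in> mixed_space k" "\<forall>x\<in>mixed_space k. mixed_form k x u = ?F x" by blast
  moreover obtain l0 l1 l2 h where "u = (l0, l1, l2, h)" by (cases u)
  ultimately have "mixed_solution M V k \<phi> l0 l1 l2 h"
    unfolding mixed_solution_iff_form by blast
  then show ?thesis by blast
qed

lemma mixed_solution_lin:
  assumes \<phi>: "\<phi> \<in> HL M k" and \<psi>: "\<psi> \<in> HL M k"
    and s: "mixed_solution M V k \<phi> l0 l1 l2 h" and t: "mixed_solution M V k \<psi> m0 m1 m2 g"
  shows "mixed_solution M V k (a *\<^sub>R \<phi> + b *\<^sub>R \<psi>) (a *\<^sub>R l0 + b *\<^sub>R m0) (a *\<^sub>R l1 + b *\<^sub>R m1)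
    (a *\<^sub>R l2 + b *\<^sub>R m2) (a *\<^sub>R h + b *\<^sub>R g)"
proof -
  let ?l = "(l0, l1, l2, h)" and ?m = "(m0, m1, m2, g)"
  note s' = mixed_solution_iff_form[THEN iffD1, OF s] and t' = mixed_solution_iff_form[THEN iffD1, OF t]
  note l = s'[THEN conjunct1] and m = t'[THEN conjunct1]
  have "mixed_form k p (a *\<^sub>R ?l + b *\<^sub>R ?m) = mixed_rhs k (a *\<^sub>R \<phi> + b *\<^sub>R \<psi>) p"
    if p: "p \<in> mixed_space k" for p
  proof -
    have \<eta>: "fst p \<in> L2_forms M k" "fst (snd p) \<in> L2_forms M (Suc k)"
      using p V_L2 by (auto simp: mixed_space_def)
    have "mixed_form k p (a *\<^sub>R ?l + b *\<^sub>R ?m) = a * mixed_form k p ?l + b * mixed_form k p ?m"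
      using linear_on_subspaceD[OF mixed_form_lin[OF p] l m, of a b] by (simp only: mixed_form_commute[of k p])
    also have "mixed_form k p ?l = mixed_rhs k \<phi> p"
      using s'[THEN conjunct2] p by (rule bspec)
    also have "mixed_form k p ?m = mixed_rhs k \<psi> p"
      using t'[THEN conjunct2] p by (rule bspec)
    also have "a * mixed_rhs k \<phi> p + b * mixed_rhs k \<psi> p = mixed_rhs k (a *\<^sub>R \<phi> + b *\<^sub>R \<psi>) p"
      unfolding mixed_rhs_def l2_lin_right[OF HL_subset_L2[OF \<phi>] HL_subset_L2[OF \<psi>] \<eta>(1)]
        l2_ext_d_lin_right[OF \<phi> \<psi> \<eta>(2)]
      by (simp add: algebra_simps)
    finally show ?thesis .
  qed
  moreover have "a *\<^sub>R ?l + b *\<^sub>R ?m \<in> mixed_space k"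
    using l m by (rule subspace_lin[OF subspace_mixed_space])
  ultimately show ?thesis
    unfolding mixed_solution_iff_form scaleR_Pair add_Pair by blast
qed

lemma mixed_solution_unique:
  assumes \<phi>: "\<phi> \<in> HL M k" and \<psi>: "\<psi> \<in> HL M k" and eq: "form_eq M \<phi> \<psi>"
    and s: "mixed_solution M V k \<phi> l0 l1 l2 h" and t: "mixed_solution M V k \<psi> m0 m1 m2 g"
  shows "form_eq M l0 m0"
proof -
  have null: "1 *\<^sub>R \<phi> + (- 1) *\<^sub>R \<psi> \<in> null_forms"
    using eq by (simp add: form_eq_iff_null)
  have "1 *\<^sub>R l0 + (- 1) *\<^sub>R m0 \<in> null_forms"
    by (rule homogeneous_solution_null(1)[OF mixed_solution_lin[OF \<phi> \<psi> s t] null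
          ext_d_null_forms[OF HL_linear[OF \<phi> \<psi>] null]])
  then show ?thesis by (simp add: form_eq_iff_null)
qed

lemma Pi_op_solution:
  assumes "\<phi> \<in> HL M k"
  shows "\<exists>l1 l2 h. mixed_solution M V k \<phi> (Pi_op M V k \<phi>) l1 l2 h"
  using someI_ex[OF mixed_solution_exists[OF assms]] unfolding Pi_op_def .

lemma Pi_op_in_V: "\<phi> \<in> HL M k \<Longrightarrow> Pi_op M V k \<phi> \<in> V k"
  using Pi_op_solution unfolding mixed_solution_iff by blast

lemma Pi_op_eqI:
  assumes "\<phi> \<in> HL M k" "\<psi> \<in> HL M k" "form_eq M \<phi> \<psi>" "mixed_solution M V k \<psi> l0 l1 l2 h"
  shows "form_eq M (Pi_op M V k \<phi>) l0"
  using Pi_op_solution[OF assms(1)] mixed_solution_unique[OF assms(1-3) _ assms(4)] by blast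

lemma form_eq_refl: "form_eq M \<alpha> \<alpha>"
  by (simp add: form_eq_def)

lemma Pi_op_cong:
  assumes "\<phi> \<in> HL M k" "\<psi> \<in> HL M k" "form_eq M \<phi> \<psi>"
  shows "form_eq M (Pi_op M V k \<phi>) (Pi_op M V k \<psi>)"
  using Pi_op_solution[OF assms(2)] Pi_op_eqI[OF assms] by blast

lemma Pi_op_lin:
  assumes \<phi>: "\<phi> \<in> HL M k" and \<psi>: "\<psi> \<in> HL M k"
  shows "form_eq M (Pi_op M V k (lin_form a \<phi> b \<psi>)) (lin_form a (Pi_op M V k \<phi>) b (Pi_op M V k \<psi>))"
proof -
  obtain l1 l2 h m1 m2 g where "mixed_solution M V k \<phi> (Pi_op M V k \<phi>) l1 l2 h"
    "mixed_solution M V k \<psi> (Pi_op M V k \<psi>) m1 m2 g"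
    using Pi_op_solution[OF \<phi>] Pi_op_solution[OF \<psi>] by blast
  from mixed_solution_lin[OF \<phi> \<psi> this, of a b]
  show ?thesis
    unfolding lin_form_eq by (rule Pi_op_eqI[OF HL_linear[OF \<phi> \<psi>] HL_linear[OF \<phi> \<psi>] form_eq_refl])
qed

lemma Pi_op_fixes_V:
  assumes l: "l \<in> V k"
  shows "form_eq M (Pi_op M V k l) l"
proof (rule Pi_op_eqI[OF V_HL[OF l] V_HL[OF l] form_eq_refl])
  show "mixed_solution M V k l l 0 0 0"
    unfolding mixed_solution_iff
    by (simp add: l zero_in_V subspace_0[OF subspace_H] l2_null_right[OF ext_d_0]
        l2_null_right[OF subspace_0[OF subspace_null_forms]])
qed

end

theorem lemma5p1:
  fixes M :: "('m, 'n::{finite,linorder}) manifold_data"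
    and V :: "nat \<Rightarrow> 'n form set"
    and k :: nat
  assumes "lipschitz_riemannian_manifold M"
    and "findim_subcomplex M V"
  shows "Pi_well_defined M V k \<and>
         projection_onto M (Pi_op M V k) (HL M k) (V k) \<and>
         (\<forall>\<phi>\<in>HL M k. form_eq M (Pi_op M V k (Pi_op M V k \<phi>)) (Pi_op M V k \<phi>)) \<and>
         (\<forall>l\<in>V k. form_eq M (Pi_op M V k l) l)"
proof -
  interpret discrete_complex M V
    using assms by unfold_locales
  have "Pi_well_defined M V k"
    unfolding Pi_well_defined_def using mixed_solution_exists mixed_solution_unique by blast
  moreover have idem: "\<forall>\<phi>\<in>HL M k. form_eq M (Pi_op M V k (Pi_op M V k \<phi>)) (Pi_op M V k \<phi>)"
    using Pi_op_fixes_V Pi_op_in_V by blast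
  moreover have "projection_onto M (Pi_op M V k) (HL M k) (V k)"
    unfolding projection_onto_def
    using Pi_op_in_V Pi_op_cong Pi_op_lin Pi_op_fixes_V V_HL idem by blast
  ultimately show ?thesis using Pi_op_fixes_V by blast
qed

end
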